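(* Let $n\ge 3$ and $d\ge 2$ be integers. The automorphism group $\mathbb{T}_n^d$ of the cube $n^d$ is generated by $\mathbb{R}_d\cup\mathbb{F}_n\cup\mathbb{X}$. Moreover, the order of $\mathbb{T}_n^d$ is $2^{d-1+k}\,d!\,k!$, where $k=\lfloor n/2\rfloor$.
   Context: Let $[n]=\{0,\dots,n-1\}$. The combinatorial cube $n^d$ is the point set $[n]^d$. A set $\ell\subseteq[n]^d$ of $n$ distinct points is a line if its points can be ordered as $(q^1,\dots,q^n)$, $q^i=[q^i_1,\dots,q^i_d]$, such that for every coordinate $j\in\{1,\dots,d\}$ the sequence $(q^1_j,\dots,q^n_j)$ is strictly increasing, strictly decreasing, or constant, and at least one of these sequences is not constant. An automorphism of $n^d$ is a permutation $P$ of $[n]^d$ such that $P(\ell)$ is a line for every line $\ell$; $\mathbb{T}_n^d$ denotes the group of all automorphisms under composition. $\mathbb{R}_d$ is the group generated by the maps $R_{ij}$ ($i\neq j$ in $\{1,\dots,d\}$), where $R_{ij}$ sends $[x_1,\dots,x_d]$ to the point whose $i$-th coordinate is $n-x_j-1$, whose $j$-th coordinate is $x_i$, and whose other coordinates are unchanged. $\mathbb{F}_n$ is the group of maps $F_\pi([x_1,\dots,x_d])=[\pi(x_1),\dots,\pi(x_d)]$ where $\pi$ is a permutation of $[n]$ with the symmetry property: $\pi(p)=q$ implies $\pi(n-p-1)=n-q-1$. $\mathbb{X}=\{\mathit{Id},X\}$ where $X([x_1,\dots,x_{d-1},x_d])=[x_1,\dots,x_d,x_{d-1}]$. *)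

theory Defs
  imports "HOL-Algebra.Bij" "HOL-Algebra.Generated_Groups" "HOL-Combinatorics.Permutations"
begin

text \<open>
  A point \<open>[x\<^sub>1, \<dots>, x\<^sub>d]\<close> is a function on the coordinate set \<open>{1..d}\<close>, made
  \<open>undefined\<close> elsewhere by \<open>\<rightarrow>\<^sub>E\<close> so that points are determined by their coordinates.
\<close>

definition cube :: "nat \<Rightarrow> nat \<Rightarrow> (nat \<Rightarrow> nat) set" where
  "cube n d = {1..d} \<rightarrow>\<^sub>E {0..<n}"

definition const_on :: "'a set \<Rightarrow> ('a \<Rightarrow> 'b) \<Rightarrow> bool" where
  "const_on A f \<longleftrightarrow> (\<exists>c. \<forall>a\<in>A. f a = c)"

definition is_line :: "nat \<Rightarrow> nat \<Rightarrow> (nat \<Rightarrow> nat) set \<Rightarrow> bool" where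
  "is_line n d L \<longleftrightarrow> L \<subseteq> cube n d \<and>
     (\<exists>q. bij_betw q {1..n} L \<and>
        (\<forall>j\<in>{1..d}. strict_mono_on {1..n} (\<lambda>i. q i j) \<or>
                    strict_antimono_on {1..n} (\<lambda>i. q i j) \<or>
                    const_on {1..n} (\<lambda>i. q i j)) \<and>
        (\<exists>j\<in>{1..d}. \<not> const_on {1..n} (\<lambda>i. q i j)))"

text \<open>
  Following \<^const>\<open>Bij\<close>, all maps on the cube below are taken to be \<open>undefined\<close> outside it;
  otherwise the set of permutations of the cube would be infinite.
\<close>

definition cube_automorphisms :: "nat \<Rightarrow> nat \<Rightarrow> ((nat \<Rightarrow> nat) \<Rightarrow> (nat \<Rightarrow> nat)) set" where
  "cube_automorphisms n d =
     {P \<in> Bij (cube n d). \<forall>L. is_line n d L \<longrightarrow> is_line n d (P ` L)}"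

definition cube_aut_group :: "nat \<Rightarrow> nat \<Rightarrow> ((nat \<Rightarrow> nat) \<Rightarrow> (nat \<Rightarrow> nat)) monoid" where
  "cube_aut_group n d = BijGroup (cube n d) \<lparr>carrier := cube_automorphisms n d\<rparr>"

definition rot :: "nat \<Rightarrow> nat \<Rightarrow> nat \<Rightarrow> nat \<Rightarrow> (nat \<Rightarrow> nat) \<Rightarrow> (nat \<Rightarrow> nat)" where
  "rot n d i j = (\<lambda>x\<in>cube n d. x(i := n - x j - 1, j := x i))"

definition rot_group :: "nat \<Rightarrow> nat \<Rightarrow> ((nat \<Rightarrow> nat) \<Rightarrow> (nat \<Rightarrow> nat)) set" where
  "rot_group n d =
     generate (BijGroup (cube n d)) {rot n d i j |i j. i \<in> {1..d} \<and> j \<in> {1..d} \<and> i \<noteq> j}"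

definition symmetric_perm :: "nat \<Rightarrow> (nat \<Rightarrow> nat) \<Rightarrow> bool" where
  "symmetric_perm n \<pi> \<longleftrightarrow> \<pi> permutes {0..<n} \<and>
     (\<forall>p\<in>{0..<n}. \<forall>q\<in>{0..<n}. \<pi> p = q \<longrightarrow> \<pi> (n - p - 1) = n - q - 1)"

definition coord_map :: "nat \<Rightarrow> nat \<Rightarrow> (nat \<Rightarrow> nat) \<Rightarrow> (nat \<Rightarrow> nat) \<Rightarrow> (nat \<Rightarrow> nat)" where
  "coord_map n d \<pi> = (\<lambda>x\<in>cube n d. \<lambda>j\<in>{1..d}. \<pi> (x j))"

definition coord_group :: "nat \<Rightarrow> nat \<Rightarrow> ((nat \<Rightarrow> nat) \<Rightarrow> (nat \<Rightarrow> nat)) set" where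
  "coord_group n d = {coord_map n d \<pi> |\<pi>. symmetric_perm n \<pi>}"

definition swap_last :: "nat \<Rightarrow> nat \<Rightarrow> (nat \<Rightarrow> nat) \<Rightarrow> (nat \<Rightarrow> nat)" where
  "swap_last n d = (\<lambda>x\<in>cube n d. x(d - 1 := x d, d := x (d - 1)))"

definition swap_group :: "nat \<Rightarrow> nat \<Rightarrow> ((nat \<Rightarrow> nat) \<Rightarrow> (nat \<Rightarrow> nat)) set" where
  "swap_group n d = {\<lambda>x\<in>cube n d. x, swap_last n d}"

text \<open>
  Automorphisms are only required to map lines to lines; closure under inverses
  holds because the cube has finitely many lines.
\<close>

lemma subgroup_cube_automorphisms:
  "subgroup (cube_automorphisms n d) (BijGroup (cube n d))"
proof (rule group.subgroupI[OF group_BijGroup])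
  let ?S = "cube n d" and ?A = "cube_automorphisms n d" and ?G = "BijGroup (cube n d)"
  have line_sub: "L \<subseteq> ?S" if "is_line n d L" for L
    using that by (simp add: is_line_def)
  show "?A \<subseteq> carrier ?G"
    by (auto simp: cube_automorphisms_def BijGroup_def)
  have "(\<lambda>x\<in>?S. x) ` L = L" if "is_line n d L" for L
    using line_sub[OF that] by (auto simp: subset_iff image_iff)
  then have "(\<lambda>x\<in>?S. x) \<in> ?A"
    by (simp add: cube_automorphisms_def id_Bij)
  then show "?A \<noteq> {}" by blast
  show "f \<otimes>\<^bsub>?G\<^esub> g \<in> ?A" if f: "f \<in> ?A" and g: "g \<in> ?A" for f g
  proof -
    have B: "f \<in> Bij ?S" "g \<in> Bij ?S" using f g by (auto simp: cube_automorphisms_def)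
    have "compose ?S f g ` L = f ` g ` L" if "is_line n d L" for L
      using line_sub[OF that] by (force simp: compose_def subset_iff image_iff)
    then show ?thesis
      using f g B by (simp add: BijGroup_def cube_automorphisms_def compose_Bij)
  qed
  show "inv\<^bsub>?G\<^esub> f \<in> ?A" if f: "f \<in> ?A" for f
  proof -
    let ?Ls = "{L. is_line n d L}"
    have B: "f \<in> Bij ?S" using f by (simp add: cube_automorphisms_def)
    then have inj: "inj_on f ?S" by (simp add: Bij_def bij_betw_def)
    have sub: "?Ls \<subseteq> Pow ?S" using line_sub by blast
    have "finite ?S" by (simp add: cube_def finite_PiE)
    then have fin: "finite ?Ls" using sub by (meson finite_Pow_iff finite_subset)
    have "inj_on ((`) f) ?Ls"
      using inj_on_image_Pow[OF inj] sub by (rule inj_on_subset)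
    moreover have "(`) f ` ?Ls \<subseteq> ?Ls" using f by (auto simp: cube_automorphisms_def)
    ultimately have surj: "(`) f ` ?Ls = ?Ls" using fin by (intro endo_inj_surj)
    have "is_line n d ((\<lambda>x\<in>?S. inv_into ?S f x) ` L)" if L: "is_line n d L" for L
    proof -
      obtain K where K: "is_line n d K" "L = f ` K" using surj L by blast
      have "(\<lambda>x\<in>?S. inv_into ?S f x) ` L = inv_into ?S f ` L"
        using line_sub[OF L] by (intro image_cong) auto
      also have "\<dots> = K"
        using K line_sub[OF K(1)] inj by (simp add: inv_into_image_cancel)
      finally show ?thesis using K by simp
    qed
    then show ?thesis
      by (simp add: inv_BijGroup[OF B] cube_automorphisms_def restrict_inv_into_Bij[OF B])
  qed
qed

lemma group_cube_aut_group: "group (cube_aut_group n d)"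
  unfolding cube_aut_group_def
  by (rule subgroup.subgroup_is_group[OF subgroup_cube_automorphisms group_BijGroup])

end

theory Submission
  imports Defs
begin

text \<open>
  A line is obtained from a point by letting a nonempty set of active coordinates run
  simultaneously through \<open>t\<close> or \<open>n - 1 - t\<close>.

  Every automorphism permutes the main diagonals, those lines on which all coordinates are active.
  For even \<open>n\<close> the points on main diagonals are exactly those lying on the maximal number
  \<open>2 ^ d - 1\<close> of lines. For odd \<open>n\<close> the main diagonals form a family of \<open>2 ^ (d - 1)\<close> concurrent
  lines such that each point of one of them, other than the common point, is collinear with two
  points of each other one; such a family can only consist of lines with the same active set, and
  is too large for a smaller active set. Looking at which points of different main diagonals are
  collinear, one sees that an automorphism acts on the diagonal \<open>(t, \<dots>, t)\<close> by a symmetric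
  permutation followed by reflections of coordinates, so one may assume that it fixes this diagonal
  pointwise.

  Write \<open>a\<close> on \<open>A\<close> for the point with coordinates \<open>a\<close> on \<open>A\<close> and \<open>0\<close> elsewhere. Among the lines
  through \<open>(0, \<dots>, 0)\<close> the edges of the cube are recognised at their points \<open>a\<close> on \<open>{j}\<close> with
  \<open>0 < a < n - 1\<close>, because no other line through such a point has its active set nested with
  \<open>{j}\<close>. Hence the automorphism permutes these edges, and after a permutation of the coordinates
  it fixes them pointwise. Then all points \<open>a\<close> on \<open>A\<close> are fixed, and finally all points, by
  induction on the number of distinct nonzero coordinates.
\<close>

locale grid =
  fixes n d :: nat
  assumes n3: "3 \<le> n" and d2: "2 \<le> d"
begin

section \<open>Lines parametrised by active coordinates and signs\<close>

definition flip :: "bool \<Rightarrow> nat \<Rightarrow> nat" where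
  "flip s t = (if s then n - 1 - t else t)"

text \<open>The values of \<open>b\<close> on \<open>A\<close> are ignored, which is what lets any
  point of a line serve as its base.\<close>

definition line_pt :: "nat set \<Rightarrow> (nat \<Rightarrow> bool) \<Rightarrow> (nat \<Rightarrow> nat) \<Rightarrow> nat \<Rightarrow> (nat \<Rightarrow> nat)" where
  "line_pt A s b t = (\<lambda>j\<in>{1..d}. if j \<in> A then flip (s j) t else b j)"

definition line_of :: "nat set \<Rightarrow> (nat \<Rightarrow> bool) \<Rightarrow> (nat \<Rightarrow> nat) \<Rightarrow> (nat \<Rightarrow> nat) set" where
  "line_of A s b = line_pt A s b ` {..<n}"

lemma flip_less: "t < n \<Longrightarrow> flip s t < n"
  by (auto simp: flip_def)

lemma flip_inj: "t < n \<Longrightarrow> u < n \<Longrightarrow> flip s t = flip s u \<longleftrightarrow> t = u"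
  by (auto simp: flip_def)

lemma flip_flip: "t < n \<Longrightarrow> flip s (flip r t) = flip (s \<noteq> r) t"
  by (auto simp: flip_def)

lemma flip_False [simp]: "flip False t = t"
  by (simp add: flip_def)

text \<open>The middle value is the only one fixed by reflection. It exists for odd \<open>n\<close>
  alone and is the reason why odd and even \<open>n\<close> need different arguments below.\<close>

lemma flip_eq_cases: "t < n \<Longrightarrow> flip s t = flip r t \<longleftrightarrow> s = r \<or> 2 * t = n - 1"
  by (auto simp: flip_def)

lemma cube_less: "x \<in> cube n d \<Longrightarrow> j \<in> {1..d} \<Longrightarrow> x j < n"
  unfolding cube_def by (drule (1) PiE_mem) simp

lemma cube_eqI:
  "x \<in> cube n d \<Longrightarrow> y \<in> cube n d \<Longrightarrow> (\<And>j. j \<in> {1..d} \<Longrightarrow> x j = y j) \<Longrightarrow> x = y"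
  unfolding cube_def by (rule PiE_ext)

lemma cube_memI: "(\<And>j. j \<in> {1..d} \<Longrightarrow> f j < n) \<Longrightarrow> restrict f {1..d} \<in> cube n d"
  unfolding cube_def by auto

lemma line_pt_apply: "j \<in> {1..d} \<Longrightarrow> line_pt A s b t j = (if j \<in> A then flip (s j) t else b j)"
  by (simp add: line_pt_def)

lemma line_pt_in_cube: "b \<in> cube n d \<Longrightarrow> t < n \<Longrightarrow> line_pt A s b t \<in> cube n d"
  unfolding line_pt_def by (rule cube_memI) (simp add: flip_less cube_less)

lemma finite_cube: "finite (cube n d)"
  by (simp add: cube_def finite_PiE)

text \<open>Strictly increasing values below \<open>n\<close> at \<open>n\<close> places leave no
  gaps: induction from the left end bounds each value from below, induction from the right end
  bounds it from above.\<close>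

lemma strict_mono_interval_eq:
  fixes f :: "nat \<Rightarrow> nat"
  assumes "strict_mono_on {1..n} f" "\<And>i. i \<in> {1..n} \<Longrightarrow> f i < n" "i \<in> {1..n}"
  shows "f i = i - 1"
proof -
  have lo: "Suc i \<le> n \<Longrightarrow> i \<le> f (Suc i)" for i
  proof (induction i)
    case (Suc i)
    then have "f (Suc i) < f (Suc (Suc i))"
      by (intro strict_mono_onD[OF assms(1)]) auto
    then show ?case using Suc by simp
  qed simp
  have hi: "k < n \<Longrightarrow> f (n - k) \<le> n - k - 1" for k
  proof (induction k)
    case 0
    then show ?case using assms(2)[of n] by auto
  next
    case (Suc k)
    have "f (n - Suc k) < f (n - k)"
      using Suc.prems by (intro strict_mono_onD[OF assms(1)]) auto
    then show ?case using Suc by simp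
  qed
  show ?thesis using lo[of "i - 1"] hi[of "n - i"] assms(3) by auto
qed

lemma strict_antimono_interval_eq:
  fixes f :: "nat \<Rightarrow> nat"
  assumes "strict_antimono_on {1..n} f" "\<And>i. i \<in> {1..n} \<Longrightarrow> f i < n" "i \<in> {1..n}"
  shows "f i = n - i"
proof -
  have "strict_mono_on {1..n} (\<lambda>i. n - 1 - f i)"
  proof (rule strict_mono_onI)
    fix r s assume "r \<in> {1..n}" "s \<in> {1..n}" "r < s"
    then have "f s < f r" using assms(1) by (auto simp: monotone_on_def)
    then show "n - 1 - f r < n - 1 - f s"
      using assms(2)[OF \<open>r \<in> {1..n}\<close>] by linarith
  qed
  from strict_mono_interval_eq[OF this _ assms(3)] have "n - 1 - f i = i - 1"
    using n3 by auto
  then show ?thesis using assms(2,3) by force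
qed

lemma line_pt_inj:
  assumes "A \<subseteq> {1..d}" "A \<noteq> {}" "t < n" "u < n" "line_pt A s b t = line_pt A s b u"
  shows "t = u"
proof -
  obtain j where j: "j \<in> A" using assms(2) by blast
  have "line_pt A s b t j = line_pt A s b u j" using assms(5) by simp
  moreover have "j \<in> {1..d}" using j assms(1) by blast
  ultimately show ?thesis using j assms(3,4) by (simp add: line_pt_apply flip_inj)
qed

lemma is_line_line_of:
  assumes "A \<subseteq> {1..d}" "A \<noteq> {}" "b \<in> cube n d"
  shows "is_line n d (line_of A s b)"
  unfolding is_line_def
proof (intro conjI exI[of _ "\<lambda>i. line_pt A s b (i - 1)"])
  show "line_of A s b \<subseteq> cube n d" using line_pt_in_cube[OF assms(3)] by (auto simp: line_of_def)
  show "bij_betw (\<lambda>i. line_pt A s b (i - 1)) {1..n} (line_of A s b)"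
    unfolding bij_betw_def
  proof
    show "inj_on (\<lambda>i. line_pt A s b (i - 1)) {1..n}"
    proof (rule inj_onI)
      fix x y assume xy: "x \<in> {1..n}" "y \<in> {1..n}" "line_pt A s b (x - 1) = line_pt A s b (y - 1)"
      have "x - 1 = y - 1" using xy by (intro line_pt_inj[OF assms(1,2) _ _ xy(3)]) auto
      then show "x = y" using xy by auto
    qed
    have "{..<n} = (\<lambda>i. i - 1) ` {1..n}"
      by (force simp: image_iff intro: bexI[of _ "Suc _"])
    then show "(\<lambda>i. line_pt A s b (i - 1)) ` {1..n} = line_of A s b"
      unfolding line_of_def by (simp add: image_image)
  qed
  show "\<forall>j\<in>{1..d}. strict_mono_on {1..n} (\<lambda>i. line_pt A s b (i - 1) j) \<or>
     strict_antimono_on {1..n} (\<lambda>i. line_pt A s b (i - 1) j) \<or>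
     const_on {1..n} (\<lambda>i. line_pt A s b (i - 1) j)"
  proof
    fix j assume j: "j \<in> {1..d}"
    consider "j \<notin> A" | "j \<in> A" "s j" | "j \<in> A" "\<not> s j" by blast
    then show "strict_mono_on {1..n} (\<lambda>i. line_pt A s b (i - 1) j) \<or>
     strict_antimono_on {1..n} (\<lambda>i. line_pt A s b (i - 1) j) \<or>
     const_on {1..n} (\<lambda>i. line_pt A s b (i - 1) j)"
    proof cases
      case 1
      then show ?thesis using j by (auto simp: const_on_def line_pt_apply)
    next
      case 2
      then have "strict_antimono_on {1..n} (\<lambda>i. line_pt A s b (i - 1) j)"
        using j by (auto simp: monotone_on_def line_pt_apply flip_def)
      then show ?thesis by blast
    next
      case 3
      then have "strict_mono_on {1..n} (\<lambda>i. line_pt A s b (i - 1) j)"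
        using j by (auto simp: monotone_on_def line_pt_apply flip_def)
      then show ?thesis by blast
    qed
  qed
  obtain j where j: "j \<in> A" using assms(2) by blast
  have "\<not> const_on {1..n} (\<lambda>i. line_pt A s b (i - 1) j)"
  proof
    assume "const_on {1..n} (\<lambda>i. line_pt A s b (i - 1) j)"
    then have "line_pt A s b (1 - 1) j = line_pt A s b (2 - 1) j"
      using n3 unfolding const_on_def by (metis atLeastAtMost_iff le_trans numeral_le_iff
          one_le_numeral order_refl semiring_norm(68) semiring_norm(69) semiring_norm(72))
    then show False using j assms(1) n3 by (auto simp: line_pt_apply flip_inj subset_iff)
  qed
  then show "\<exists>j\<in>{1..d}. \<not> const_on {1..n} (\<lambda>i. line_pt A s b (i - 1) j)"
    using j assms(1) by blast
qed

text \<open>Without gaps, each coordinate that is not constant must run through all values below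
  \<open>n\<close>, upwards or downwards. So every line is given by a set \<open>A\<close>, signs
  \<open>s\<close> and a base point.\<close>

lemma is_line_obtain:
  assumes "is_line n d L"
  obtains A s b where "A \<subseteq> {1..d}" "A \<noteq> {}" "b \<in> cube n d" "L = line_of A s b"
proof -
  from assms obtain q where L: "L \<subseteq> cube n d" and q: "bij_betw q {1..n} L"
    and m: "\<And>j. j \<in> {1..d} \<Longrightarrow> strict_mono_on {1..n} (\<lambda>i. q i j) \<or>
                    strict_antimono_on {1..n} (\<lambda>i. q i j) \<or>
                    const_on {1..n} (\<lambda>i. q i j)"
    and nc: "\<exists>j\<in>{1..d}. \<not> const_on {1..n} (\<lambda>i. q i j)"
    unfolding is_line_def by blast
  have qL: "q ` {1..n} = L" using q by (simp add: bij_betw_def)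
  then have qc: "i \<in> {1..n} \<Longrightarrow> q i \<in> cube n d" for i using L by blast
  define A where "A = {j\<in>{1..d}. \<not> const_on {1..n} (\<lambda>i. q i j)}"
  define s where "s j = strict_antimono_on {1..n} (\<lambda>i. q i j)" for j
  define b where "b = q 1"
  have b: "b \<in> cube n d" using qc[of 1] n3 by (simp add: b_def)
  have eq: "q i = line_pt A s b (i - 1)" if i: "i \<in> {1..n}" for i
  proof (rule cube_eqI)
    show "q i \<in> cube n d" using qc i .
    show "line_pt A s b (i - 1) \<in> cube n d" using i by (intro line_pt_in_cube b) auto
    fix j assume j: "j \<in> {1..d}"
    have lt: "\<And>i. i \<in> {1..n} \<Longrightarrow> q i j < n" using cube_less[OF qc j] .
    show "q i j = line_pt A s b (i - 1) j"
    proof (cases "j \<in> A")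
      case False
      then have "const_on {1..n} (\<lambda>i. q i j)" using j by (simp add: A_def)
      moreover have "1 \<in> {1..n}" using n3 by simp
      ultimately have "q i j = q 1 j" using i unfolding const_on_def by metis
      then show ?thesis using False j by (simp add: line_pt_apply b_def)
    next
      case True
      show ?thesis
      proof (cases "s j")
        case s: True
        then have "q i j = n - i"
          using strict_antimono_interval_eq[OF _ lt i] by (simp add: s_def)
        then show ?thesis using True s j i by (auto simp: line_pt_apply flip_def)
      next
        case False
        then have "strict_mono_on {1..n} (\<lambda>i. q i j)"
          using m[OF j] True by (auto simp: s_def A_def)
        then have "q i j = i - 1" using strict_mono_interval_eq[OF _ lt i] by simp
        then show ?thesis using True False j by (simp add: line_pt_apply)
      qed
    qed
  qed
  have "{..<n} = (\<lambda>i. i - 1) ` {1..n}"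
    by (force simp: image_iff intro: bexI[of _ "Suc _"])
  then have "line_of A s b = (\<lambda>i. line_pt A s b (i - 1)) ` {1..n}"
    unfolding line_of_def by (simp add: image_image)
  also have "\<dots> = L" using eq qL by (metis (mono_tags, lifting) image_cong)
  finally have "L = line_of A s b" ..
  moreover have "A \<noteq> {}" using nc by (auto simp: A_def)
  moreover have "A \<subseteq> {1..d}" by (auto simp: A_def)
  ultimately show thesis using that b by blast
qed

lemma line_sub_cube: "is_line n d L \<Longrightarrow> L \<subseteq> cube n d"
  by (simp add: is_line_def)

lemma line_pt_memD: "x \<in> line_of A s b \<Longrightarrow> \<exists>t<n. x = line_pt A s b t"
  by (auto simp: line_of_def)

text \<open>Signs matter only up to a common complement, which merely traverses the line in the
  opposite direction.\<close>

lemma line_of_flip: "line_of A (\<lambda>j. s j \<noteq> r) b = line_of A s b"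
proof -
  have "line_pt A (\<lambda>j. s j \<noteq> r) b t = line_pt A s b (flip r t)" if "t < n" for t
    using that by (auto simp: line_pt_def flip_flip fun_eq_iff)
  moreover have "flip r ` {..<n} = {..<n}"
    by (rule endo_inj_surj) (auto simp: inj_on_def flip_inj flip_less)
  moreover have "line_pt A s b ` flip r ` {..<n} = (\<lambda>t. line_pt A s b (flip r t)) ` {..<n}"
    by (rule image_image)
  ultimately show ?thesis unfolding line_of_def by auto
qed

lemma line_of_base_cong:
  assumes "\<And>j. j \<in> {1..d} \<Longrightarrow> j \<notin> A \<Longrightarrow> b j = c j" "\<And>j. j \<in> A \<Longrightarrow> s j = r j"
  shows "line_of A s b = line_of A r c"
proof -
  have "line_pt A s b = line_pt A r c" using assms by (auto simp: line_pt_def fun_eq_iff)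
  then show ?thesis by (simp add: line_of_def)
qed

text \<open>Normal form of a line relative to one of its points: \<open>z\<close> is the base, and
  with \<open>i\<close> unreflected the parameter of \<open>z\<close> is its coordinate
  \<open>z i\<close>.\<close>

lemma line_through:
  assumes "is_line n d L" "z \<in> L"
  obtains A i s where "A \<subseteq> {1..d}" "i \<in> A" "\<not> s i" "z \<in> cube n d" "L = line_of A s z"
    "\<And>j. j \<in> A \<Longrightarrow> z j = flip (s j) (z i)"
proof -
  obtain A s b where A: "A \<subseteq> {1..d}" "A \<noteq> {}" "b \<in> cube n d" "L = line_of A s b"
    using is_line_obtain[OF assms(1)] .
  obtain i where i: "i \<in> A" using A by blast
  obtain t where t: "t < n" "z = line_pt A s b t" using line_pt_memD A assms(2) by blast
  define r where "r j = (s j \<noteq> s i)" for j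
  have "L = line_of A r b" unfolding A(4) r_def by (rule line_of_flip[symmetric])
  also have "\<dots> = line_of A r z" using t by (intro line_of_base_cong) (auto simp: line_pt_apply)
  finally have L: "L = line_of A r z" .
  have ij: "j \<in> {1..d}" if "j \<in> A" for j using that A by blast
  show thesis
  proof (rule that[OF A(1) i _ _ L])
    show "\<not> r i" by (simp add: r_def)
    show "z \<in> cube n d" using assms line_sub_cube by blast
    fix j assume "j \<in> A"
    then show "z j = flip (r j) (z i)" using ij[of j] ij[OF i] i t
      by (cases "s j"; cases "s i") (auto simp: line_pt_apply r_def flip_flip)
  qed
qed

lemma line_pt_self:
  assumes "A \<subseteq> {1..d}" "z \<in> cube n d" "\<And>j. j \<in> A \<Longrightarrow> z j = flip (s j) t" "t < n"
  shows "line_pt A s z t = z"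
  using assms by (intro cube_eqI line_pt_in_cube) (auto simp: line_pt_apply)

lemma line_of_self:
  assumes "A \<subseteq> {1..d}" "z \<in> cube n d" "\<And>j. j \<in> A \<Longrightarrow> z j = flip (s j) t" "t < n"
  shows "z \<in> line_of A s z"
  using line_pt_self[OF assms] assms(4) unfolding line_of_def by (metis image_eqI lessThan_iff)

text \<open>The coordinates in which \<open>x\<close> and \<open>y\<close> differ are the active
  ones. The relative signs can be read off from either point unless it sits at the middle value, and
  distinct points of one line cannot both sit there.\<close>

lemma line_unique:
  assumes "is_line n d L" "is_line n d M" "x \<in> L" "x \<in> M" "y \<in> L" "y \<in> M" "x \<noteq> y"
  shows "L = M"
proof -
  obtain A i s where A: "A \<subseteq> {1..d}" "i \<in> A" "\<not> s i" "x \<in> cube n d" "L = line_of A s x"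
    "\<And>j. j \<in> A \<Longrightarrow> x j = flip (s j) (x i)"
    using line_through[OF assms(1,3)] by blast
  obtain B k r where B: "B \<subseteq> {1..d}" "k \<in> B" "\<not> r k" "x \<in> cube n d" "M = line_of B r x"
    "\<And>j. j \<in> B \<Longrightarrow> x j = flip (r j) (x k)"
    using line_through[OF assms(2,4)] by blast
  obtain t where t: "t < n" "y = line_pt A s x t" using line_pt_memD A assms(5) by blast
  obtain u where u: "u < n" "y = line_pt B r x u" using line_pt_memD B assms(6) by blast
  have ij: "i \<in> {1..d}" "k \<in> {1..d}" using A B by auto
  have xl: "x i < n" "x k < n" using ij A(4) cube_less by blast+
  have "t \<noteq> x i" using line_pt_self[OF A(1,4,6) xl(1)] t assms(7) by auto
  have "u \<noteq> x k" using line_pt_self[OF B(1,4,6) xl(2)] u assms(7) by auto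
  have yA: "y j \<noteq> x j \<longleftrightarrow> j \<in> A" if "j \<in> {1..d}" for j
    using that A(6)[of j] \<open>t \<noteq> x i\<close> t xl by (auto simp: line_pt_apply flip_inj)
  have yB: "y j \<noteq> x j \<longleftrightarrow> j \<in> B" if "j \<in> {1..d}" for j
    using that B(6)[of j] \<open>u \<noteq> x k\<close> u xl by (auto simp: line_pt_apply flip_inj)
  have AB: "A = B" using yA yB A(1) B(1) by blast
  have eq: "flip (s j) (x i) = flip (r j) (x k)" "flip (s j) t = flip (r j) u" if "j \<in> A" for j
  proof -
    show "flip (s j) (x i) = flip (r j) (x k)" using that A(6) B(6) AB by metis
    have "line_pt A s x t j = line_pt B r x u j" using t u by simp
    then show "flip (s j) t = flip (r j) u" using that AB A(1) by (auto simp: line_pt_apply subset_iff)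
  qed
  have xk: "x k = flip (r i) (x i)" using eq(1)[OF A(2)] xl A(3) by (auto simp: flip_def)
  have uk: "u = flip (r i) t" using eq(2)[OF A(2)] u t A(3) by (auto simp: flip_def)
  have "r j = (s j \<noteq> r i)" if "j \<in> A" for j
    using eq[OF that] xk uk t(1) xl \<open>t \<noteq> x i\<close> unfolding xk uk
    by (simp only: flip_flip flip_eq_cases) linarith
  then have "line_of B r x = line_of A (\<lambda>j. s j \<noteq> r i) x" unfolding AB[symmetric] by (intro line_of_base_cong) auto
  then show ?thesis using A B line_of_flip by simp
qed

section \<open>Collinearity of points\<close>

definition collinear :: "(nat \<Rightarrow> nat) \<Rightarrow> (nat \<Rightarrow> nat) \<Rightarrow> bool" where
  "collinear x y \<longleftrightarrow> (\<exists>L. is_line n d L \<and> x \<in> L \<and> y \<in> L)"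

text \<open>Two parameters \<open>p\<close> and \<open>q\<close> on a line leave inactive
  coordinates equal and give each active one the pair \<open>(p, q)\<close> or its mirror image.
  This turns later questions about collinearity into arithmetic; equal points are included, with
  arbitrary \<open>p\<close> and \<open>q\<close>.\<close>

lemma collinear_iff:
  assumes "x \<in> cube n d" "y \<in> cube n d"
  shows "collinear x y \<longleftrightarrow> (\<exists>p q. p < n \<and> q < n \<and> p \<noteq> q \<and> (\<forall>j\<in>{1..d}. x j = y j \<or>
     (x j = p \<and> y j = q) \<or> (x j = n - 1 - p \<and> y j = n - 1 - q)))"
proof
  assume "collinear x y"
  then obtain L where L: "is_line n d L" "x \<in> L" "y \<in> L" unfolding collinear_def by blast
  obtain A i s where A: "A \<subseteq> {1..d}" "i \<in> A" "\<not> s i" "x \<in> cube n d" "L = line_of A s x"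
    "\<And>j. j \<in> A \<Longrightarrow> x j = flip (s j) (x i)"
    using line_through[OF L(1,2)] by blast
  obtain t where t: "t < n" "y = line_pt A s x t" using line_pt_memD A L by blast
  have xi: "x i < n" using A cube_less by blast
  show "\<exists>p q. p < n \<and> q < n \<and> p \<noteq> q \<and> (\<forall>j\<in>{1..d}. x j = y j \<or>
     (x j = p \<and> y j = q) \<or> (x j = n - 1 - p \<and> y j = n - 1 - q))"
  proof (cases "t = x i")
    case True
    then have "x = y" using line_pt_self[OF A(1,4,6) xi] t by auto
    then show ?thesis using n3 by (intro exI[of _ 0] exI[of _ 1]) auto
  next
    case False
    have "x j = y j \<or> (x j = x i \<and> y j = t) \<or> (x j = n - 1 - x i \<and> y j = n - 1 - t)"
      if "j \<in> {1..d}" for j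
      using that A(6)[of j] t(2) by (cases "j \<in> A"; cases "s j") (auto simp: line_pt_apply flip_def)
    then show ?thesis using t(1) xi False by metis
  qed
next
  assume "\<exists>p q. p < n \<and> q < n \<and> p \<noteq> q \<and> (\<forall>j\<in>{1..d}. x j = y j \<or>
     (x j = p \<and> y j = q) \<or> (x j = n - 1 - p \<and> y j = n - 1 - q))"
  then obtain p q where pq: "p < n" "q < n" "p \<noteq> q" and
    h: "\<And>j. j \<in> {1..d} \<Longrightarrow> x j = y j \<or>
     (x j = p \<and> y j = q) \<or> (x j = n - 1 - p \<and> y j = n - 1 - q)" by blast
  show "collinear x y"
  proof (cases "x = y")
    case True
    have "1 \<in> {1..d}" using d2 by simp
    then have "is_line n d (line_of {1} (\<lambda>_. False) x)" "x \<in> line_of {1} (\<lambda>_. False) x"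
      using assms cube_less by (auto intro!: is_line_line_of line_of_self[of _ _ _ "x 1"])
    then show ?thesis using True unfolding collinear_def by blast
  next
    case False
    define A where "A = {j \<in> {1..d}. x j \<noteq> y j}"
    define s where "s j = (\<not> (x j = p \<and> y j = q))" for j
    have A: "A \<noteq> {}" using False cube_eqI[OF assms] unfolding A_def by blast
    have "x j = flip (s j) p \<and> y j = flip (s j) q" if "j \<in> A" for j
      using h[of j] that by (auto simp: A_def s_def flip_def)
    note sA = this
    have "line_pt A s x p = x" using sA pq
      by (intro line_pt_self assms) (auto simp: A_def)
    moreover have "line_pt A s x q = y" using sA pq
      by (intro cube_eqI line_pt_in_cube assms) (auto simp: A_def line_pt_apply)
    ultimately have "x \<in> line_of A s x" "y \<in> line_of A s x"
      using pq unfolding line_of_def by (metis image_eqI lessThan_iff)+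
    moreover have "is_line n d (line_of A s x)" using A assms by (intro is_line_line_of) (auto simp: A_def)
    ultimately show ?thesis unfolding collinear_def by blast
  qed
qed


subsection \<open>Main diagonals\<close>

lemma aut_cube: "P \<in> cube_automorphisms n d \<Longrightarrow> x \<in> cube n d \<Longrightarrow> P x \<in> cube n d"
  by (auto simp: cube_automorphisms_def Bij_def bij_betw_def)

lemma aut_line: "P \<in> cube_automorphisms n d \<Longrightarrow> is_line n d L \<Longrightarrow> is_line n d (P ` L)"
  by (simp add: cube_automorphisms_def)

lemma aut_inj:
  "P \<in> cube_automorphisms n d \<Longrightarrow> x \<in> cube n d \<Longrightarrow> y \<in> cube n d \<Longrightarrow> P x = P y \<longleftrightarrow> x = y"
  by (auto simp: cube_automorphisms_def Bij_def bij_betw_def inj_on_def)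

lemma aut_compose:
  "P \<in> cube_automorphisms n d \<Longrightarrow> Q \<in> cube_automorphisms n d \<Longrightarrow>
    compose (cube n d) P Q \<in> cube_automorphisms n d"
  using subgroup.m_closed[OF subgroup_cube_automorphisms, of P n d Q]
  by (simp add: BijGroup_def cube_automorphisms_def)

lemma aut_inverse:
  assumes "P \<in> cube_automorphisms n d"
  obtains Q where "Q \<in> cube_automorphisms n d"
    "\<forall>x\<in>cube n d. Q (P x) = x" "\<forall>x\<in>cube n d. P (Q x) = x"
proof -
  have B: "P \<in> Bij (cube n d)" using assms by (simp add: cube_automorphisms_def)
  then have bb: "bij_betw P (cube n d) (cube n d)" by (simp add: Bij_def)
  define Q where "Q = (\<lambda>x\<in>cube n d. inv_into (cube n d) P x)"
  have "Q \<in> cube_automorphisms n d"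
    using subgroup.m_inv_closed[OF subgroup_cube_automorphisms assms]
    by (simp add: Q_def inv_BijGroup[OF B])
  moreover have "Q (P x) = x" if "x \<in> cube n d" for x
    using that bb aut_cube[OF assms] by (simp add: Q_def bij_betw_inv_into_left)
  moreover have "P (Q x) = x" if "x \<in> cube n d" for x
    using that bb by (simp add: Q_def bij_betw_inv_into_right)
  ultimately show thesis using that by blast
qed

text \<open>The inverse is again an automorphism, so non-collinearity is preserved too; the
  transport of isolation below depends on this direction.\<close>

lemma aut_collinear:
  assumes "P \<in> cube_automorphisms n d" "x \<in> cube n d" "y \<in> cube n d"
  shows "collinear (P x) (P y) \<longleftrightarrow> collinear x y"
proof -
  have *: "collinear (R u) (R v)" if "R \<in> cube_automorphisms n d" "collinear u v" for R u v
    using that aut_line unfolding collinear_def by blast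
  obtain Q where Q: "Q \<in> cube_automorphisms n d"
    "\<forall>x\<in>cube n d. Q (P x) = x" "\<forall>x\<in>cube n d. P (Q x) = x"
    using aut_inverse[OF assms(1)] .
  show ?thesis using *[OF assms(1), of x y] *[OF Q(1), of "P x" "P y"] Q(2) assms(2,3) by auto
qed

section \<open>Active coordinates of a line\<close>

text \<open>Defined from the point set, so that it does not depend on a choice of
  parametrisation.\<close>

definition active :: "(nat \<Rightarrow> nat) set \<Rightarrow> nat set" where
  "active L = {j \<in> {1..d}. \<exists>x\<in>L. \<exists>y\<in>L. x j \<noteq> y j}"

lemma active_line_of:
  assumes "A \<subseteq> {1..d}"
  shows "active (line_of A s z) = A"
proof
  show "active (line_of A s z) \<subseteq> A"
    by (auto simp: active_def line_of_def line_pt_apply split: if_splits)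
  show "A \<subseteq> active (line_of A s z)"
  proof
    fix j assume j: "j \<in> A"
    then have "line_pt A s z 0 j \<noteq> line_pt A s z 1 j"
      using assms n3 by (auto simp: line_pt_apply flip_inj subset_iff)
    moreover have "line_pt A s z 0 \<in> line_of A s z" "line_pt A s z 1 \<in> line_of A s z"
      using n3 by (auto simp: line_of_def)
    ultimately show "j \<in> active (line_of A s z)" using j assms unfolding active_def by blast
  qed
qed

lemma active_subset: "active L \<subseteq> {1..d}"
  by (auto simp: active_def)

lemma active_nonempty: "is_line n d L \<Longrightarrow> active L \<noteq> {}"
  by (metis is_line_obtain active_line_of)

lemma line_at:
  assumes "is_line n d L" "z \<in> L" "i \<in> active L"
  obtains s where "\<not> s i" "L = line_of (active L) s z" "\<And>j. j \<in> active L \<Longrightarrow> z j = flip (s j) (z i)"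
proof -
  obtain A k s where A: "A \<subseteq> {1..d}" "k \<in> A" "\<not> s k" "z \<in> cube n d" "L = line_of A s z"
    "\<And>j. j \<in> A \<Longrightarrow> z j = flip (s j) (z k)"
    using line_through[OF assms(1,2)] by blast
  have a: "active L = A" using A active_line_of by simp
  have zk: "z k < n" using A cube_less by blast
  define r where "r j = (s j \<noteq> s i)" for j
  have "L = line_of A r z" unfolding A(5) r_def by (rule line_of_flip[symmetric])
  moreover have "z j = flip (r j) (z i)" if "j \<in> A" for j
    using A(6)[OF that] A(6)[of i] assms(3) a zk
    by (cases "s i"; cases "s j") (auto simp: r_def flip_flip)
  ultimately show thesis using that[of r] a by (simp add: r_def)
qed

lemma line_point_eq:
  assumes "is_line n d L" "x \<in> L" "y \<in> L" "i \<in> active L" "x i = y i"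
  shows "x = y"
proof -
  obtain A s b where A: "A \<subseteq> {1..d}" "A \<noteq> {}" "b \<in> cube n d" "L = line_of A s b"
    using is_line_obtain[OF assms(1)] .
  obtain t where t: "t < n" "x = line_pt A s b t" using A line_pt_memD assms by blast
  obtain u where u: "u < n" "y = line_pt A s b u" using A line_pt_memD assms by blast
  have "i \<in> A" using assms A active_line_of by simp
  then have "t = u" using assms(5) A(1) t u by (auto simp: line_pt_apply flip_inj subset_iff)
  then show ?thesis using t u by simp
qed

lemma line_const:
  assumes "x \<in> L" "y \<in> L" "i \<in> {1..d}" "i \<notin> active L"
  shows "x i = y i"
  using assms by (auto simp: active_def)

lemma line_point_at:
  assumes "is_line n d L" "i \<in> active L" "t < n"
  obtains x where "x \<in> L" "x i = t"
proof -
  obtain A s b where A: "A \<subseteq> {1..d}" "A \<noteq> {}" "b \<in> cube n d" "L = line_of A s b"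
    using is_line_obtain[OF assms(1)] .
  have i: "i \<in> A" "i \<in> {1..d}" using assms A active_line_of by auto
  have "line_pt A s b (flip (s i) t) \<in> L" using A assms by (simp add: line_of_def flip_less)
  moreover have "line_pt A s b (flip (s i) t) i = t" using i assms by (simp add: line_pt_apply flip_flip)
  ultimately show thesis using that by blast
qed

text \<open>Where \<open>z\<close> is not at the middle value, its coordinates reveal the relative
  signs, so the active set alone determines a line through \<open>z\<close>. At the middle value
  several lines may share an active set.\<close>

lemma line_eq_if_active_eq:
  assumes "is_line n d L" "is_line n d M" "z \<in> L" "z \<in> M" "active L = active M"
    "i \<in> active L" "2 * z i \<noteq> n - 1"
  shows "L = M"
proof -
  obtain s where s: "\<not> s i" "L = line_of (active L) s z" "\<And>j. j \<in> active L \<Longrightarrow> z j = flip (s j) (z i)"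
    using line_at[OF assms(1,3,6)] by blast
  obtain r where r: "\<not> r i" "M = line_of (active M) r z" "\<And>j. j \<in> active M \<Longrightarrow> z j = flip (r j) (z i)"
    using line_at[OF assms(2,4)] assms by metis
  have zi: "z i < n" using assms active_subset line_sub_cube cube_less by blast
  have "s j = r j" if "j \<in> active L" for j
    using flip_eq_cases[OF zi, of "s j" "r j"] s(3)[OF that] r(3)[of j] that assms(5,7) by simp
  then have "line_of (active L) s z = line_of (active L) r z" by (intro line_of_base_cong) auto
  then have "L = line_of (active M) r z" using trans[OF s(2)] by (simp only: assms(5))
  then show ?thesis using r(2) by (rule trans[OF _ sym])
qed

definition maindiag :: "(nat \<Rightarrow> nat) set \<Rightarrow> bool" where
  "maindiag L \<longleftrightarrow> is_line n d L \<and> active L = {1..d}"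

definition diag_pt :: "(nat \<Rightarrow> bool) \<Rightarrow> nat \<Rightarrow> (nat \<Rightarrow> nat)" where
  "diag_pt s t = (\<lambda>j\<in>{1..d}. flip (s j) t)"

lemma diag_pt_apply: "j \<in> {1..d} \<Longrightarrow> diag_pt s t j = flip (s j) t"
  by (simp add: diag_pt_def)

lemma diag_pt_in_cube: "t < n \<Longrightarrow> diag_pt s t \<in> cube n d"
  unfolding diag_pt_def by (intro cube_memI flip_less)

lemma line_of_full: "line_of {1..d} s z = diag_pt s ` {..<n}"
proof -
  have "line_pt {1..d} s z = diag_pt s" by (auto simp: line_pt_def diag_pt_def fun_eq_iff)
  then show ?thesis by (simp add: line_of_def)
qed

lemma coordinates_nonempty: "1 \<in> {1..d}" "{1..d} \<noteq> {}"
  using d2 by auto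

lemma maindiag_diag_pt: "maindiag (diag_pt s ` {..<n})"
proof -
  have "is_line n d (line_of {1..d} s (diag_pt s 0))"
    using n3 coordinates_nonempty(2) by (intro is_line_line_of diag_pt_in_cube) auto
  then show ?thesis unfolding maindiag_def
    by (metis line_of_full active_line_of order_refl)
qed

lemma maindiag_iff: "maindiag L \<longleftrightarrow> (\<exists>s. L = diag_pt s ` {..<n})"
  by (metis is_line_obtain active_line_of line_of_full maindiag_def maindiag_diag_pt)

lemma exists_off_class:
  obtains t where "t < n" "t \<noteq> b" "t \<noteq> n - 1 - b"
proof -
  have "\<not> (\<forall>t\<in>{0,1,2}. t = b \<or> t = n - 1 - b)" by auto
  then obtain t where "t \<in> {0,1,2}" "\<not> (t = b \<or> t = n - 1 - b)" by blast
  then show thesis using that[of t] n3 by auto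
qed

definition on_diagonal :: "(nat \<Rightarrow> nat) \<Rightarrow> bool" where
  "on_diagonal z \<longleftrightarrow> (\<exists>L. maindiag L \<and> z \<in> L)"

lemma on_diagonal_iff: "on_diagonal z \<longleftrightarrow> (\<exists>s t. t < n \<and> z = diag_pt s t)"
  by (auto simp: on_diagonal_def maindiag_iff)

text \<open>On a main diagonal any two coordinates of a point agree up to reflection. An inactive
  coordinate stays constant while an active one takes every value, so some point of any other line
  violates this.\<close>

lemma maindiag_if_diag_points:
  assumes "is_line n d L" "\<And>z. z \<in> L \<Longrightarrow> on_diagonal z"
  shows "maindiag L"
proof (rule ccontr)
  assume "\<not> maindiag L"
  then obtain j where j: "j \<in> {1..d}" "j \<notin> active L"
    using assms(1) active_subset unfolding maindiag_def by blast
  obtain i where i: "i \<in> active L" using active_nonempty[OF assms(1)] by blast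
  then have i': "i \<in> {1..d}" using active_subset by blast
  obtain x0 where x0: "x0 \<in> L" using line_point_at[OF assms(1) i, of 0] n3 by auto
  obtain t where t: "t < n" "t \<noteq> x0 j" "t \<noteq> n - 1 - x0 j" by (rule exists_off_class)
  obtain x where x: "x \<in> L" "x i = t" using line_point_at[OF assms(1) i t(1)] .
  have xj: "x j = x0 j" using line_const x x0 j by blast
  obtain s u where "u < n" "x = diag_pt s u" using assms(2)[OF x(1)] on_diagonal_iff by blast
  then have "t = x0 j \<or> t = n - 1 - x0 j"
    using x(2) xj diag_pt_apply[OF i', of s u] diag_pt_apply[OF j(1), of s u]
    by (cases "s i"; cases "s j") (auto simp: flip_def)
  then show False using t by blast
qed

section \<open>Automorphisms preserve main diagonals\<close>

lemma finite_lines: "finite {L. is_line n d L \<and> z \<in> L}"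
proof -
  have "{L. is_line n d L \<and> z \<in> L} \<subseteq> Pow (cube n d)" using line_sub_cube by blast
  then show ?thesis using finite_cube by (meson finite_Pow_iff finite_subset)
qed

lemma aut_image_inj:
  assumes "P \<in> cube_automorphisms n d"
  shows "inj_on ((`) P) {L. is_line n d L}"
proof -
  have "inj_on P (cube n d)" using aut_inj[OF assms] by (auto simp: inj_on_def)
  then show ?thesis using line_sub_cube by (intro inj_on_subset[OF inj_on_image_Pow]) auto
qed

text \<open>Without a middle value, a line through a given point is determined by its active set, so
  a point lies on at most as many lines as there are nonempty sets of coordinates. Points on main
  diagonals attain this bound, and \<open>P\<close> carries the lines through \<open>z\<close>
  injectively to lines through \<open>P z\<close>.\<close>

lemma aut_on_diagonal_even:
  assumes P: "P \<in> cube_automorphisms n d" and "even n" and z: "on_diagonal z"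
  shows "on_diagonal (P z)"
proof -
  obtain s t where st: "t < n" "z = diag_pt s t" using z on_diagonal_iff by blast
  have zc: "z \<in> cube n d" using st diag_pt_in_cube by simp
  let ?Ls = "\<lambda>z. {L. is_line n d L \<and> z \<in> L}"
  let ?F = "Pow {1..d} - {{}}"
  have "2 * a \<noteq> n - 1" for a using \<open>even n\<close> n3 by presburger
  then have "L = M" if "L \<in> ?Ls w" "M \<in> ?Ls w" "active L = active M" for w L M
    using that active_nonempty[of L] line_eq_if_active_eq[of L M w] by auto
  then have inj: "inj_on active (?Ls w)" for w by (intro inj_onI)
  have sub: "active ` ?Ls w \<subseteq> ?F" for w using active_nonempty active_subset by blast
  have "?F \<subseteq> active ` ?Ls z"
  proof
    fix A assume A: "A \<in> ?F"
    have "is_line n d (line_of A s z)" using A zc by (intro is_line_line_of) auto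
    moreover have "z \<in> line_of A s z"
      using A zc st by (intro line_of_self[of _ _ _ t]) (auto simp: diag_pt_apply subset_iff)
    moreover have "active (line_of A s z) = A" using A by (intro active_line_of) auto
    ultimately show "A \<in> active ` ?Ls z" by blast
  qed
  then have "card ?F \<le> card (?Ls z)" using finite_lines
    by (meson card_image_le card_mono finite_imageI order_trans)
  also have "\<dots> \<le> card (?Ls (P z))"
    using aut_line[OF P] finite_lines
    by (intro card_inj_on_le[of "(`) P"] inj_on_subset[OF aut_image_inj[OF P]]) auto
  also have "\<dots> = card (active ` ?Ls (P z))" using inj by (simp add: card_image)
  finally have "active ` ?Ls (P z) = ?F" using sub by (intro card_seteq) auto
  then have "{1..d} \<in> active ` ?Ls (P z)" using coordinates_nonempty by blast
  then show ?thesis unfolding on_diagonal_def maindiag_def by auto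
qed

text \<open>
  Distinct lines through \<open>z\<close> with the same active set, on which \<open>z\<close> has the middle value, are
  doubly linked: the two points of \<open>M\<close> collinear with \<open>x\<close> are the one at the same position and
  its mirror image. Lines with nested active sets only give one such point.
\<close>

definition doubly_linked :: "(nat \<Rightarrow> nat) \<Rightarrow> (nat \<Rightarrow> nat) set \<Rightarrow> (nat \<Rightarrow> nat) set \<Rightarrow> bool" where
  "doubly_linked z L M \<longleftrightarrow> (\<forall>x\<in>L - {z}. \<exists>y\<in>M - {z}. \<exists>y'\<in>M - {z}. y \<noteq> y' \<and> collinear x y \<and> collinear x y')"

text \<open>Suppose \<open>i\<close> is active on \<open>L\<close> only. Every \<open>y\<close> on
  \<open>M\<close> has \<open>y i = z i\<close>, so the pair \<open>(x i, z i)\<close> already fixes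
  the parameters up to mirror image, and these leave a single choice for \<open>y k\<close>, hence
  at most one \<open>y\<close> other than \<open>z\<close>.\<close>

lemma doubly_linked_active:
  assumes L: "is_line n d L" and M: "is_line n d M" and z: "z \<in> L" "z \<in> M"
    and str: "doubly_linked z L M"
  shows "active L \<subseteq> active M"
proof (rule ccontr)
  assume "\<not> active L \<subseteq> active M"
  then obtain i where i: "i \<in> active L" "i \<notin> active M" by blast
  then have i': "i \<in> {1..d}" using active_subset by blast
  obtain k where k: "k \<in> active M" using active_nonempty[OF M] by blast
  then have k': "k \<in> {1..d}" using active_subset by blast
  have zc: "z \<in> cube n d" using z L line_sub_cube by blast
  obtain s where s: "\<not> s i" "L = line_of (active L) s z" "\<And>j. j \<in> active L \<Longrightarrow> z j = flip (s j) (z i)"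
    using line_at[OF L z(1) i(1)] by blast
  have zi: "z i < n" "z k < n" using zc i' k' cube_less by blast+
  \<comment> \<open>The value \<open>a\<close> avoids \<open>z i\<close>, to obtain a point other
    than \<open>z\<close>, and the middle value, so that \<open>a\<close> and its mirror image can
    be told apart. At most two of the three candidates are excluded.\<close>
  have "\<not> (\<forall>a\<in>{0,1,2}. a = z i \<or> 2 * a = n - 1)" by auto
  then obtain a where "a \<in> {0,1,2}" and a: "a \<noteq> z i" "2 * a \<noteq> n - 1" by blast
  then have an: "a < n" using n3 by auto
  note a = an a
  define x where "x = line_pt (active L) s z a"
  have xL: "x \<in> L" using a s(2) by (auto simp: x_def line_of_def)
  have xc: "x \<in> cube n d" using xL L line_sub_cube by blast
  have xi: "x i = a" using i i' s by (simp add: x_def line_pt_apply)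
  have "\<exists>f. \<forall>y\<in>M - {z}. collinear x y \<longrightarrow> y k = f"
  proof (intro exI ballI impI)
    fix y assume y: "y \<in> M - {z}" "collinear x y"
    have yc: "y \<in> cube n d" using y M line_sub_cube by blast
    have yi: "y i = z i" using line_const y z i i' by blast
    have yk: "y k \<noteq> z k" using line_point_eq[OF M _ z(2) k] y by blast
    have ykn: "y k < n" using yc k' cube_less by blast
    obtain p q where pq: "p < n" "q < n" "p \<noteq> q"
      "\<And>j. j \<in> {1..d} \<Longrightarrow> x j = y j \<or> (x j = p \<and> y j = q) \<or> (x j = n - 1 - p \<and> y j = n - 1 - q)"
      using y(2) collinear_iff[OF xc yc] by blast
    have ci: "(a = p \<and> z i = q) \<or> (a = n - 1 - p \<and> z i = n - 1 - q)"
      using pq(4)[OF i'] xi yi a by metis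
    show "y k = (if k \<in> active L then x k else if z k = a then z i else n - 1 - z i)"
    proof (cases "k \<in> active L")
      case True
      then have "x k = flip (s k) a" "z k = flip (s k) (z i)" using k' s by (simp_all add: x_def line_pt_apply)
      then show ?thesis using True ci pq(1-3) pq(4)[OF k'] yk a zi
        by (cases "s k") (auto simp: flip_def)
    next
      case False
      then have "x k = z k" using k' by (simp add: x_def line_pt_apply)
      then show ?thesis using False ci pq(1-3) pq(4)[OF k'] yk a zi by auto
    qed
  qed
  then obtain f where f: "\<And>y. y \<in> M - {z} \<Longrightarrow> collinear x y \<Longrightarrow> y k = f" by blast
  have "x \<noteq> z" using xi a by auto
  then obtain y y' where "y \<in> M - {z}" "y' \<in> M - {z}" "y \<noteq> y'" "collinear x y" "collinear x y'"
    using str xL unfolding doubly_linked_def by blast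
  then show False using f line_point_eq[OF M _ _ k] by (metis Diff_iff)
qed

lemma doubly_linked_aut:
  assumes P: "P \<in> cube_automorphisms n d" and "is_line n d L" "is_line n d M" "z \<in> cube n d"
    and str: "doubly_linked z L M"
  shows "doubly_linked (P z) (P ` L) (P ` M)"
  unfolding doubly_linked_def
proof
  fix x' assume "x' \<in> P ` L - {P z}"
  then obtain x where x: "x \<in> L - {z}" "x' = P x" by blast
  then obtain y y' where y: "y \<in> M - {z}" "y' \<in> M - {z}" "y \<noteq> y'" "collinear x y" "collinear x y'"
    using str unfolding doubly_linked_def by blast
  have c: "x \<in> cube n d" "y \<in> cube n d" "y' \<in> cube n d"
    using x y assms line_sub_cube by blast+
  have "P y \<in> P ` M - {P z}" "P y' \<in> P ` M - {P z}" using y c assms aut_inj[OF P] by auto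
  moreover have "P y \<noteq> P y'" "collinear x' (P y)" "collinear x' (P y')"
    using y c x aut_inj[OF P] aut_collinear[OF P] by auto
  ultimately show "\<exists>y\<in>P ` M - {P z}. \<exists>y'\<in>P ` M - {P z}. y \<noteq> y' \<and> collinear x' y \<and> collinear x' y'"
    by blast
qed

lemma doubly_linked_maindiag:
  assumes "2 * m = n - 1" "maindiag L" "maindiag M"
  shows "doubly_linked (diag_pt (\<lambda>_. False) m) L M"
  unfolding doubly_linked_def
proof
  let ?c = "diag_pt (\<lambda>_. False) m"
  obtain s r where L: "L = diag_pt s ` {..<n}" and M: "M = diag_pt r ` {..<n}"
    using assms(2,3) unfolding maindiag_iff by blast
  have cm: "diag_pt q m = ?c" for q
    using assms(1) by (auto simp: diag_pt_def flip_def fun_eq_iff)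
  fix x assume x: "x \<in> L - {?c}"
  then obtain a where a: "a < n" "x = diag_pt s a" "a \<noteq> m" using L cm by auto
  define y where "y = diag_pt r a"
  define y' where "y' = diag_pt r (n - 1 - a)"
  have y1: "y 1 = flip (r 1) a" "y' 1 = flip (r 1) (n - 1 - a)" "?c 1 = m"
    using coordinates_nonempty by (simp_all add: y_def y'_def diag_pt_apply)
  have "y \<in> M" "y' \<in> M" using M a by (auto simp: y_def y'_def)
  moreover have "y 1 \<noteq> y' 1" "y 1 \<noteq> ?c 1" "y' 1 \<noteq> ?c 1"
    using y1 a assms(1) n3 by (cases "r 1"; simp add: flip_def; linarith)+
  \<comment> \<open>Coordinates that differ carry \<open>a\<close> and its mirror image in one order
    or the other, so \<open>p = a\<close> and \<open>q = n - 1 - a\<close> witness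
    collinearity.\<close>
  moreover have cl: "collinear x (diag_pt r b)" if "b = a \<or> b = n - 1 - a" for b
  proof -
    have "x j = diag_pt r b j \<or> (x j = a \<and> diag_pt r b j = n - 1 - a) \<or>
        (x j = n - 1 - a \<and> diag_pt r b j = n - 1 - (n - 1 - a))" if "j \<in> {1..d}" for j
      using \<open>b = a \<or> b = n - 1 - a\<close> that a(1)
      by (cases "s j"; cases "r j") (auto simp: a(2) diag_pt_apply flip_def)
    moreover have "b < n" "n - 1 - a < n" "a \<noteq> n - 1 - a"
      using that a assms(1) by auto
    ultimately show ?thesis
      using a(1) diag_pt_in_cube collinear_iff[of x "diag_pt r b"] unfolding a(2) by blast
  qed
  moreover have "collinear x y" "collinear x y'" using cl unfolding y_def y'_def by blast+
  ultimately show "\<exists>y\<in>M - {?c}. \<exists>y'\<in>M - {?c}. y \<noteq> y' \<and> collinear x y \<and> collinear x y'"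
    by (metis DiffI empty_iff insert_iff)
qed

text \<open>Leaving coordinate \<open>1\<close> unreflected selects one sign pattern from each
  complementary pair, so distinct subsets of \<open>{2..d}\<close> give distinct diagonals.\<close>

lemma card_maindiag: "2 ^ (d - 1) \<le> card {L. maindiag L}"
proof -
  let ?f = "\<lambda>S. diag_pt (\<lambda>j. j \<in> S) ` {..<n}"
  have "inj_on ?f (Pow {2..d})"
  proof (rule inj_onI)
    fix S T assume S: "S \<in> Pow {2..d}" and T: "T \<in> Pow {2..d}" and eq: "?f S = ?f T"
    have "diag_pt (\<lambda>j. j \<in> S) 0 \<in> ?f T" using eq n3 by auto
    then obtain t where t: "t < n" "diag_pt (\<lambda>j. j \<in> S) 0 = diag_pt (\<lambda>j. j \<in> T) t" by auto
    have e: "flip (j \<in> S) 0 = flip (j \<in> T) t" if "j \<in> {1..d}" for j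
      using t(2) that by (metis diag_pt_apply)
    have "1 \<notin> S" "1 \<notin> T" using S T by auto
    then have "t = 0" using e[OF coordinates_nonempty(1)] by simp
    then have "j \<in> S \<longleftrightarrow> j \<in> T" if "j \<in> {1..d}" for j
      using e[OF that] n3 by (auto simp: flip_def split: if_splits)
    then show "S = T" using S T by auto
  qed
  moreover have "?f ` Pow {2..d} \<subseteq> {L. maindiag L}" using maindiag_diag_pt by auto
  moreover have "finite {L. maindiag L}"
  proof -
    have "{L. maindiag L} \<subseteq> Pow (cube n d)" using line_sub_cube by (auto simp: maindiag_def)
    then show ?thesis using finite_cube by (meson finite_Pow_iff finite_subset)
  qed
  ultimately have "card (Pow {2..d}) \<le> card {L. maindiag L}" by (rule card_inj_on_le)
  then show ?thesis by (simp add: card_Pow)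
qed

text \<open>With the sign at \<open>i\<close> normalised, the signs on the remaining
  \<open>card A - 1\<close> coordinates determine the line.\<close>

lemma card_lines_with_active:
  assumes "i \<in> A" "finite A"
  shows "card {L. is_line n d L \<and> w \<in> L \<and> active L = A} \<le> 2 ^ (card A - 1)"
proof -
  let ?K = "{L. is_line n d L \<and> w \<in> L \<and> active L = A}"
  have "\<exists>s. \<not> s i \<and> L = line_of A s w" if "L \<in> ?K" for L
  proof -
    have L: "is_line n d L" "w \<in> L" "i \<in> active L" "active L = A" using that assms(1) by auto
    obtain s where "\<not> s i" "L = line_of (active L) s w" using line_at[OF L(1-3)] .
    then show ?thesis unfolding L(4) by blast
  qed
  then obtain s where s: "\<And>L. L \<in> ?K \<Longrightarrow> \<not> s L i \<and> L = line_of A (s L) w" by metis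
  let ?g = "\<lambda>L. {j \<in> A - {i}. s L j}"
  have "inj_on ?g ?K"
  proof (rule inj_onI)
    fix L M assume L: "L \<in> ?K" and M: "M \<in> ?K" and eq: "?g L = ?g M"
    have "s L j = s M j" if "j \<in> A" for j
      using eq s[OF L] s[OF M] that by (cases "j = i") blast+
    then have "line_of A (s L) w = line_of A (s M) w" by (intro line_of_base_cong) auto
    then show "L = M" using s[OF L] s[OF M] by simp
  qed
  then have "card ?K \<le> card (Pow (A - {i}))"
    using assms by (intro card_inj_on_le[of ?g]) auto
  then show ?thesis using assms by (simp add: card_Pow)
qed

text \<open>All main diagonals meet in the centre \<open>c\<close> and are doubly linked there, in
  both directions, so their images have a common active set \<open>A\<close>. Injectivity on lines
  then bounds \<open>2 ^ (d - 1)\<close> by \<open>2 ^ (card A - 1)\<close>, which leaves only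
  \<open>A = {1..d}\<close>.\<close>

lemma aut_maindiag_odd:
  assumes P: "P \<in> cube_automorphisms n d" and "odd n" and L: "maindiag L"
  shows "maindiag (P ` L)"
proof -
  obtain m where m: "2 * m = n - 1" using \<open>odd n\<close> by (elim oddE) simp
  have mn: "m < n" using m n3 by linarith
  define c where "c = diag_pt (\<lambda>_. False) m"
  have cc: "c \<in> cube n d" using mn by (simp add: c_def diag_pt_in_cube)
  have cM: "c \<in> M" if M: "maindiag M" for M
  proof -
    obtain r where r: "M = diag_pt r ` {..<n}" using M unfolding maindiag_iff by blast
    have "c = diag_pt r m" using m by (auto simp: c_def diag_pt_def flip_def fun_eq_iff)
    then show ?thesis using r mn by blast
  qed
  have line: "is_line n d M" if "maindiag M" for M using that by (simp add: maindiag_def)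
  have "active (P ` M) \<subseteq> active (P ` N)" if "maindiag M" "maindiag N" for M N
  proof (rule doubly_linked_active)
    show "doubly_linked (P c) (P ` M) (P ` N)"
      using doubly_linked_aut[OF P line line cc] doubly_linked_maindiag[OF m] that unfolding c_def by blast
  qed (use that cM aut_line[OF P] line in auto)
  then have eq: "active (P ` M) = active (P ` L)" if "maindiag M" for M using that L by blast
  define A where "A = active (P ` L)"
  have lL: "is_line n d (P ` L)" using aut_line[OF P] line L by blast
  have Af: "finite A" "A \<subseteq> {1..d}" using active_subset finite_subset unfolding A_def by blast+
  obtain i where i: "i \<in> A" using active_nonempty[OF lL] A_def by blast
  let ?K = "{L. is_line n d L \<and> P c \<in> L \<and> active L = A}"
  have "2 ^ (d - 1) \<le> card {L. maindiag L}" by (rule card_maindiag)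
  also have "\<dots> \<le> card ?K"
  proof (rule card_inj_on_le)
    show "inj_on ((`) P) {L. maindiag L}"
      using aut_image_inj[OF P] by (rule inj_on_subset) (auto simp: maindiag_def)
    show "(`) P ` {L. maindiag L} \<subseteq> ?K"
      using cM eq aut_line[OF P] line by (auto simp: A_def)
    show "finite ?K" using finite_lines[of "P c"] by (rule rev_finite_subset) auto
  qed
  also have "\<dots> \<le> 2 ^ (card A - 1)" by (rule card_lines_with_active[OF i Af(1)])
  finally have "d - 1 \<le> card A - 1" by simp
  moreover have "card A > 0" using i Af(1) card_gt_0_iff by blast
  ultimately have "d \<le> card A" using d2 by linarith
  then have "A = {1..d}" using Af by (intro card_seteq) auto
  then show ?thesis using lL by (simp add: maindiag_def A_def)
qed

lemma aut_maindiag: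
  assumes P: "P \<in> cube_automorphisms n d" and L: "maindiag L"
  shows "maindiag (P ` L)"
proof (cases "even n")
  case True
  show ?thesis
  proof (rule maindiag_if_diag_points)
    show "is_line n d (P ` L)" using aut_line[OF P] L by (simp add: maindiag_def)
    show "on_diagonal z" if "z \<in> P ` L" for z
      using that aut_on_diagonal_even[OF P True] L unfolding on_diagonal_def by blast
  qed
qed (rule aut_maindiag_odd[OF P _ L])


subsection \<open>Signed coordinate permutations and symmetric permutations of values\<close>

text \<open>Coordinates are pulled back along \<open>\<sigma>\<close>, so composing two such maps
  composes the permutations in reverse order.\<close>

definition signed_perm_map :: "(nat \<Rightarrow> nat) \<Rightarrow> (nat \<Rightarrow> bool) \<Rightarrow> (nat \<Rightarrow> nat) \<Rightarrow> (nat \<Rightarrow> nat)" where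
  "signed_perm_map \<sigma> s = (\<lambda>x\<in>cube n d. \<lambda>j\<in>{1..d}. flip (s j) (x (\<sigma> j)))"

lemma signed_perm_map_apply:
  "x \<in> cube n d \<Longrightarrow> j \<in> {1..d} \<Longrightarrow> signed_perm_map \<sigma> s x j = flip (s j) (x (\<sigma> j))"
  by (simp add: signed_perm_map_def)

lemma signed_perm_map_in_cube:
  assumes "\<sigma> permutes {1..d}" "x \<in> cube n d"
  shows "signed_perm_map \<sigma> s x \<in> cube n d"
proof -
  have "flip (s j) (x (\<sigma> j)) < n" if "j \<in> {1..d}" for j
    using that assms permutes_in_image[OF assms(1), of j] by (intro flip_less cube_less) auto
  then have "(\<lambda>j\<in>{1..d}. flip (s j) (x (\<sigma> j))) \<in> cube n d" by (rule cube_memI)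
  then show ?thesis using assms(2) by (simp add: signed_perm_map_def)
qed

lemma bij_cubeI:
  assumes "f \<in> extensional (cube n d)" "\<And>x. x \<in> cube n d \<Longrightarrow> f x \<in> cube n d"
    "inj_on f (cube n d)"
  shows "f \<in> Bij (cube n d)"
  using assms endo_inj_surj[OF finite_cube, of f] by (auto simp: Bij_def bij_betw_def)

lemma signed_perm_map_aut:
  assumes \<sigma>: "\<sigma> permutes {1..d}"
  shows "signed_perm_map \<sigma> s \<in> cube_automorphisms n d"
proof -
  have in_iff: "\<sigma> j \<in> {1..d} \<longleftrightarrow> j \<in> {1..d}" for j using permutes_in_image[OF \<sigma>] .
  have "inj_on (signed_perm_map \<sigma> s) (cube n d)"
  proof (rule inj_onI)
    fix x y assume x: "x \<in> cube n d" and y: "y \<in> cube n d"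
      and eq: "signed_perm_map \<sigma> s x = signed_perm_map \<sigma> s y"
    show "x = y"
    proof (rule cube_eqI[OF x y])
      fix k assume "k \<in> {1..d}"
      then obtain j where j: "j \<in> {1..d}" "k = \<sigma> j"
        using permutes_image[OF \<sigma>] by (metis imageE)
      have "flip (s j) (x k) = flip (s j) (y k)"
        using arg_cong[OF eq, of "\<lambda>f. f j"] j x y by (simp add: signed_perm_map_apply)
      then show "x k = y k" using flip_inj x y \<open>k \<in> {1..d}\<close> cube_less by blast
    qed
  qed
  then have B: "signed_perm_map \<sigma> s \<in> Bij (cube n d)"
    using signed_perm_map_in_cube[OF \<sigma>]
    by (intro bij_cubeI) (auto simp: signed_perm_map_def)
  have "is_line n d (signed_perm_map \<sigma> s ` L)" if L: "is_line n d L" for L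
  proof -
    obtain A r b where A: "A \<subseteq> {1..d}" "A \<noteq> {}" "b \<in> cube n d" "L = line_of A r b"
      using is_line_obtain[OF L] .
    \<comment> \<open>The image line has the preimage of \<open>A\<close> under
      \<open>\<sigma>\<close> as active set, and the two reflections of a coordinate combine to an
      exclusive or; the parameter \<open>t\<close> is unchanged.\<close>
    define A' where "A' = {j \<in> {1..d}. \<sigma> j \<in> A}"
    define r' where "r' j = (s j \<noteq> r (\<sigma> j))" for j
    have "signed_perm_map \<sigma> s (line_pt A r b t) = line_pt A' r' (signed_perm_map \<sigma> s b) t" if t: "t < n" for t
    proof (rule cube_eqI)
      fix j assume j: "j \<in> {1..d}"
      then show "signed_perm_map \<sigma> s (line_pt A r b t) j = line_pt A' r' (signed_perm_map \<sigma> s b) t j"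
        using in_iff[of j] t A(3)
        by (auto simp: signed_perm_map_apply line_pt_apply line_pt_in_cube A'_def r'_def flip_flip)
    qed (use t A in \<open>auto intro!: line_pt_in_cube signed_perm_map_in_cube[OF \<sigma>]\<close>)
    then have "signed_perm_map \<sigma> s ` L = line_of A' r' (signed_perm_map \<sigma> s b)"
      unfolding A(4) line_of_def by (auto simp: image_iff)
    moreover have "A' \<noteq> {}"
    proof -
      obtain k where k: "k \<in> A" using A by blast
      then have "k \<in> \<sigma> ` {1..d}" using permutes_image[OF \<sigma>] A by auto
      then show ?thesis using k by (auto simp: A'_def)
    qed
    ultimately show ?thesis using A
      by (auto intro!: is_line_line_of signed_perm_map_in_cube[OF \<sigma>] simp: A'_def)
  qed
  then show ?thesis using B by (simp add: cube_automorphisms_def)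
qed

lemma symmetric_perm_less: "symmetric_perm n \<pi> \<Longrightarrow> t < n \<Longrightarrow> \<pi> t < n"
  using permutes_in_image[of \<pi> "{0..<n}" t] by (auto simp: symmetric_perm_def)

text \<open>The symmetry property says that \<open>\<pi>\<close> commutes with reflection. Hence on
  a line \<open>coord_map\<close> permutes the parameters and keeps active set and signs.\<close>

lemma symmetric_perm_flip:
  assumes "symmetric_perm n \<pi>" "t < n"
  shows "\<pi> (flip s t) = flip s (\<pi> t)"
proof -
  have "\<pi> (n - t - 1) = n - \<pi> t - 1"
    using assms symmetric_perm_less[OF assms] by (auto simp: symmetric_perm_def)
  then show ?thesis by (auto simp: flip_def)
qed

lemma coord_map_apply:
  "x \<in> cube n d \<Longrightarrow> j \<in> {1..d} \<Longrightarrow> coord_map n d \<pi> x j = \<pi> (x j)"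
  by (simp add: coord_map_def)

lemma coord_map_in_cube:
  assumes "symmetric_perm n \<pi>" "x \<in> cube n d"
  shows "coord_map n d \<pi> x \<in> cube n d"
proof -
  have "(\<lambda>j\<in>{1..d}. \<pi> (x j)) \<in> cube n d"
    using symmetric_perm_less[OF assms(1)] cube_less[OF assms(2)] by (intro cube_memI) blast
  then show ?thesis using assms(2) by (simp add: coord_map_def)
qed

lemma coord_map_aut:
  assumes \<pi>: "symmetric_perm n \<pi>"
  shows "coord_map n d \<pi> \<in> cube_automorphisms n d"
proof -
  have p: "\<pi> permutes {0..<n}" using \<pi> by (simp add: symmetric_perm_def)
  have "inj_on (coord_map n d \<pi>) (cube n d)"
  proof (rule inj_onI)
    fix x y assume x: "x \<in> cube n d" and y: "y \<in> cube n d"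
      and eq: "coord_map n d \<pi> x = coord_map n d \<pi> y"
    show "x = y"
    proof (rule cube_eqI[OF x y])
      fix k assume k: "k \<in> {1..d}"
      have "\<pi> (x k) = \<pi> (y k)"
        using arg_cong[OF eq, of "\<lambda>f. f k"] k x y by (simp add: coord_map_apply)
      then show "x k = y k" using permutes_inj[OF p] by (simp add: inj_eq)
    qed
  qed
  then have B: "coord_map n d \<pi> \<in> Bij (cube n d)"
    using coord_map_in_cube[OF \<pi>]
    by (intro bij_cubeI) (auto simp: coord_map_def)
  have "is_line n d (coord_map n d \<pi> ` L)" if L: "is_line n d L" for L
  proof -
    obtain A r b where A: "A \<subseteq> {1..d}" "A \<noteq> {}" "b \<in> cube n d" "L = line_of A r b"
      using is_line_obtain[OF L] .
    have "coord_map n d \<pi> (line_pt A r b t) = line_pt A r (coord_map n d \<pi> b) (\<pi> t)" if t: "t < n" for t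
    proof (rule cube_eqI)
      fix j assume j: "j \<in> {1..d}"
      then show "coord_map n d \<pi> (line_pt A r b t) j = line_pt A r (coord_map n d \<pi> b) (\<pi> t) j"
        using t A(3)
        by (auto simp: coord_map_apply line_pt_apply line_pt_in_cube symmetric_perm_flip[OF \<pi>])
    qed (use t A in \<open>auto intro!: line_pt_in_cube coord_map_in_cube[OF \<pi>] symmetric_perm_less[OF \<pi>]\<close>)
    then have "coord_map n d \<pi> ` L = line_pt A r (coord_map n d \<pi> b) ` \<pi> ` {..<n}"
      unfolding A(4) line_of_def by (simp add: image_image)
    also have "\<pi> ` {..<n} = {..<n}" using permutes_image[OF p] by (simp add: lessThan_atLeast0)
    finally have "coord_map n d \<pi> ` L = line_of A r (coord_map n d \<pi> b)" by (simp add: line_of_def)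
    then show ?thesis using A by (auto intro!: is_line_line_of coord_map_in_cube[OF \<pi>])
  qed
  then show ?thesis using B by (simp add: cube_automorphisms_def)
qed

section \<open>Action of an automorphism on a main diagonal\<close>

definition const_pt :: "nat \<Rightarrow> nat \<Rightarrow> nat" where
  "const_pt t = diag_pt (\<lambda>_. False) t"

lemma const_pt_apply: "j \<in> {1..d} \<Longrightarrow> const_pt t j = t"
  by (simp add: const_pt_def diag_pt_apply)

lemma const_pt_in_cube: "t < n \<Longrightarrow> const_pt t \<in> cube n d"
  by (simp add: const_pt_def diag_pt_in_cube)

lemma colI:
  assumes "x \<in> cube n d" "y \<in> cube n d" "p < n" "q < n" "p \<noteq> q"
    "\<And>j. j \<in> {1..d} \<Longrightarrow> x j = y j \<or> (x j = p \<and> y j = q) \<or> (x j = n - 1 - p \<and> y j = n - 1 - q)"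
  shows "collinear x y"
  using assms(3-6) unfolding collinear_iff[OF assms(1,2)] by blast

lemma colE:
  assumes "collinear x y" "x \<in> cube n d" "y \<in> cube n d"
  obtains p q where "p < n" "q < n" "p \<noteq> q"
    "\<And>j. j \<in> {1..d} \<Longrightarrow> x j = y j \<or> (x j = p \<and> y j = q) \<or> (x j = n - 1 - p \<and> y j = n - 1 - q)"
  using assms(1) unfolding collinear_iff[OF assms(2,3)] by blast

lemma exists_other_coordinate:
  obtains k where "k \<in> {1..d}" "k \<noteq> i"
proof -
  have "(if i = 1 then 2 else 1) \<in> {1..d}" "(if i = 1 then 2 else 1) \<noteq> i" using d2 by auto
  then show thesis using that by blast
qed

lemma aut_on_diagonal: "P \<in> cube_automorphisms n d \<Longrightarrow> on_diagonal x \<Longrightarrow> on_diagonal (P x)"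
  using aut_maindiag unfolding on_diagonal_def by blast

lemma on_diagonal_in_cube: "on_diagonal x \<Longrightarrow> x \<in> cube n d"
  unfolding on_diagonal_iff using diag_pt_in_cube by blast

text \<open>The centre lies on all main diagonals, of which there are at least two, while any other
  point lies on at most one. The inverse of \<open>P\<close> maps main diagonals through
  \<open>P x\<close> to main diagonals through \<open>x\<close>, so only the centre can be sent to
  the centre.\<close>

lemma aut_mid:
  assumes P: "P \<in> cube_automorphisms n d" and x: "on_diagonal x" and m: "2 * P x 1 = n - 1"
  shows "2 * x 1 = n - 1"
proof (rule ccontr)
  assume nx: "2 * x 1 \<noteq> n - 1"
  have xc: "x \<in> cube n d" using on_diagonal_in_cube[OF x] .
  obtain Q where Q: "Q \<in> cube_automorphisms n d"
    "\<forall>x\<in>cube n d. Q (P x) = x" "\<forall>x\<in>cube n d. P (Q x) = x"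
    using aut_inverse[OF P] .
  obtain s t where st: "t < n" "P x = diag_pt s t" using aut_on_diagonal[OF P x] on_diagonal_iff by blast
  have t: "2 * t = n - 1" using m st diag_pt_apply[OF coordinates_nonempty(1), of s t] by (auto simp: flip_def split: if_splits)
  have mem: "P x \<in> diag_pt r ` {..<n}" for r
  proof -
    have "P x = diag_pt r t" using st t by (auto simp: diag_pt_def flip_def fun_eq_iff)
    then show ?thesis using st by blast
  qed
  have 1: "is_line n d (Q ` diag_pt r ` {..<n})" "active (Q ` diag_pt r ` {..<n}) = {1..d}"
    "x \<in> Q ` diag_pt r ` {..<n}" for r
    using aut_maindiag[OF Q(1) maindiag_diag_pt, of r] imageI[OF mem, of Q r] Q(2) xc
    by (auto simp: maindiag_def)
  have 2: "Q ` diag_pt r ` {..<n} = Q ` diag_pt r' ` {..<n}" for r r'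
    by (rule line_eq_if_active_eq[of _ _ x 1]) (use 1 nx coordinates_nonempty in auto)
  let ?r = "\<lambda>j. j \<noteq> (1::nat)" and ?r' = "\<lambda>_::nat. False"
  have lm: "is_line n d (diag_pt r ` {..<n})" for r using maindiag_diag_pt by (simp add: maindiag_def)
  have "diag_pt ?r ` {..<n} = diag_pt ?r' ` {..<n}"
    using aut_image_inj[OF Q(1)] 2[of ?r ?r'] lm unfolding inj_on_def by blast
  then have "diag_pt ?r 0 \<in> diag_pt ?r' ` {..<n}" using n3 by auto
  then obtain u where u: "u < n" "diag_pt ?r 0 = diag_pt ?r' u" by auto
  have "2 \<in> {1..d}" using d2 by simp
  then show False using arg_cong[OF u(2), of "\<lambda>f. f 1"] arg_cong[OF u(2), of "\<lambda>f. f 2"] coordinates_nonempty n3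
    by (simp add: diag_pt_apply flip_def)
qed

text \<open>Since the first point is off the diagonal of \<open>s\<close>, the signs
  \<open>q\<close> and \<open>s\<close> agree at some coordinate and differ at another. The former
  gives a condition on \<open>v\<close> and \<open>u\<close>, the latter one on \<open>v\<close> and
  the mirror image of \<open>u\<close>; a single pair of parameters meets both only if the positions
  match up to reflection.\<close>

lemma collinear_diag_points:
  assumes "v < n" "u < n" "diag_pt q v \<notin> diag_pt s ` {..<n}" "collinear (diag_pt q v) (diag_pt s u)" "2 * u \<noteq> n - 1"
  shows "u = v \<or> u = n - 1 - v"
proof -
  have "\<exists>i\<in>{1..d}. q i = s i"
  proof (rule ccontr)
    assume "\<not> (\<exists>i\<in>{1..d}. q i = s i)"
    then have "diag_pt q v = diag_pt s (n - 1 - v)"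
      using assms(1) by (auto simp: diag_pt_def flip_def fun_eq_iff)
    then show False using assms by auto
  qed
  then obtain i where i: "i \<in> {1..d}" "q i = s i" by blast
  have "\<exists>i\<in>{1..d}. q i \<noteq> s i"
  proof (rule ccontr)
    assume "\<not> (\<exists>i\<in>{1..d}. q i \<noteq> s i)"
    then have "diag_pt q v = diag_pt s v"
      by (auto simp: diag_pt_def fun_eq_iff)
    then show False using assms by auto
  qed
  then obtain k where k: "k \<in> {1..d}" "q k \<noteq> s k" by blast
  \<comment> \<open>Naming the mirror images and relating them by sums avoids truncated subtraction
    in the case analysis.\<close>
  define v' u' where "v' = n - 1 - v" and "u' = n - 1 - u"
  have vu: "v + v' = n - 1" "u + u' = n - 1" using assms(1,2) by (auto simp: v'_def u'_def)
  obtain a b where ab: "a < n" "b < n" "a \<noteq> b"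
    "\<And>j. j \<in> {1..d} \<Longrightarrow> diag_pt q v j = diag_pt s u j \<or> (diag_pt q v j = a \<and> diag_pt s u j = b) \<or>
      (diag_pt q v j = n - 1 - a \<and> diag_pt s u j = n - 1 - b)"
    using colE[OF assms(4)] assms diag_pt_in_cube by blast
  have "diag_pt q v = diag_pt s v" if "2 * v = n - 1"
    using that by (auto simp: diag_pt_def flip_def fun_eq_iff)
  then have "2 * v \<noteq> n - 1" using assms(1,3) by auto
  moreover have "(v = u \<or> (v = a \<and> u = b) \<or> (v = n - 1 - a \<and> u = n - 1 - b)) \<or>
      (v' = u' \<or> (v' = a \<and> u' = b) \<or> (v' = n - 1 - a \<and> u' = n - 1 - b))"
    using ab(4)[OF i(1)] i by (cases "s i") (simp_all add: diag_pt_apply flip_def v'_def u'_def)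
  moreover have "(v = u' \<or> (v = a \<and> u' = b) \<or> (v = n - 1 - a \<and> u' = n - 1 - b)) \<or>
      (v' = u \<or> (v' = a \<and> u = b) \<or> (v' = n - 1 - a \<and> u = n - 1 - b))"
    using ab(4)[OF k(1)] k by (cases "s k") (simp_all add: diag_pt_apply flip_def v'_def u'_def)
  moreover have "a + (n - 1 - a) = n - 1" "b + (n - 1 - b) = n - 1" using ab(1,2) by auto
  moreover define a' b' where "a' = n - 1 - a" and "b' = n - 1 - b"
  ultimately have "u = v \<or> u = v'" using vu ab(3) assms(5)
    unfolding a'_def[symmetric] b'_def[symmetric] by (elim disjE conjE) linarith+
  then show ?thesis by (simp add: v'_def)
qed

lemma aut_diagonal_form:
  assumes P: "P \<in> cube_automorphisms n d"
  obtains s \<pi> where "symmetric_perm n \<pi>" "\<forall>t<n. P (const_pt t) = diag_pt s (\<pi> t)"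
proof -
  let ?\<delta> = "diag_pt (\<lambda>_. False) ` {..<n}"
  obtain s where s: "P ` ?\<delta> = diag_pt s ` {..<n}"
    using aut_maindiag[OF P maindiag_diag_pt] unfolding maindiag_iff by blast
  have "\<forall>t. \<exists>u. t < n \<longrightarrow> u < n \<and> P (const_pt t) = diag_pt s u"
    using s unfolding const_pt_def by blast
  then obtain f where f: "\<And>t. t < n \<Longrightarrow> f t < n \<and> P (const_pt t) = diag_pt s (f t)" by metis
  define \<pi> where "\<pi> t = (if t < n then f t else t)" for t
  have \<pi>: "\<pi> t < n" "P (const_pt t) = diag_pt s (\<pi> t)" if "t < n" for t
    using f that by (auto simp: \<pi>_def)
  have inj: "inj_on \<pi> {0..<n}"
  proof (rule inj_onI)
    fix t u assume tu: "t \<in> {0..<n}" "u \<in> {0..<n}" "\<pi> t = \<pi> u"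
    then have "P (const_pt t) = P (const_pt u)" using \<pi> by auto
    then have "const_pt t = const_pt u" using aut_inj[OF P] const_pt_in_cube tu by auto
    then show "t = u" using const_pt_apply[OF coordinates_nonempty(1)] by metis
  qed
  have perm: "\<pi> permutes {0..<n}"
  proof (rule bij_imp_permutes)
    show "bij_betw \<pi> {0..<n} {0..<n}"
      using inj endo_inj_surj[of "{0..<n}" \<pi>] \<pi>(1) by (simp add: bij_betw_def image_subset_iff)
  qed (simp add: \<pi>_def)
  have dp: "on_diagonal (const_pt t)" if "t < n" for t using that by (auto simp: on_diagonal_iff const_pt_def)
  obtain Q where Q: "Q \<in> cube_automorphisms n d"
    "\<forall>x\<in>cube n d. Q (P x) = x" "\<forall>x\<in>cube n d. P (Q x) = x"
    using aut_inverse[OF P] .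
  have mid1: "2 * P (const_pt t) 1 = n - 1 \<longleftrightarrow> 2 * \<pi> t = n - 1" if "t < n" for t
    using \<pi>[OF that] coordinates_nonempty(1) by (auto simp: diag_pt_apply flip_def)
  \<comment> \<open>The centre is treated first, using \<open>P\<close> and its inverse, because
    collinearity does not reveal positions there.\<close>
  have mid: "2 * \<pi> t = n - 1 \<longleftrightarrow> 2 * t = n - 1" if t: "t < n" for t
    using aut_mid[OF P dp[OF t]] aut_mid[OF Q(1) aut_on_diagonal[OF P dp[OF t]]]
      Q(2) const_pt_in_cube[OF t] mid1[OF t] const_pt_apply[OF coordinates_nonempty(1), of t] by auto
  have sym: "\<pi> (n - 1 - t) = n - 1 - \<pi> t" if t: "t < n" for t
  proof (cases "2 * t = n - 1")
    case True
    then have "n - 1 - t = t" by simp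
    moreover have "2 * \<pi> t = n - 1" using mid[OF t] True by simp
    ultimately show ?thesis by simp
  next
    case False
    define t' where "t' = n - 1 - t"
    have t': "t' < n" "t \<noteq> t'" "2 * t' \<noteq> n - 1" "t = n - 1 - t'" using t False n3 by (auto simp: t'_def)
    \<comment> \<open>\<open>z\<close> is on another diagonal and collinear with the points at
      positions \<open>t\<close> and \<open>t'\<close>. Its image sits at some position
      \<open>v\<close> off the diagonal of \<open>s\<close>, so both image positions are
      \<open>v\<close> or the mirror image of \<open>v\<close>; being distinct, they are mirror
      images of each other.\<close>
    define z where "z = diag_pt (\<lambda>j. j \<noteq> 1) t"
    have zc: "z \<in> cube n d" using t by (simp add: z_def diag_pt_in_cube)
    have z: "z j = (if j = 1 then t else t')" if "j \<in> {1..d}" for j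
      using that by (simp add: z_def diag_pt_apply flip_def t'_def)
    have "collinear z (const_pt t)"
      by (rule colI[of _ _ t' t]) (use t t' z zc const_pt_in_cube const_pt_apply in auto)
    moreover have "collinear z (const_pt t')"
      by (rule colI[of _ _ t t']) (use t t' z zc const_pt_in_cube const_pt_apply in auto)
    ultimately have c: "collinear (P z) (diag_pt s (\<pi> t))" "collinear (P z) (diag_pt s (\<pi> t'))"
      using aut_collinear[OF P zc] const_pt_in_cube t t' \<pi> by metis+
    have "on_diagonal z" using t by (auto simp: z_def on_diagonal_iff)
    then obtain q v where v: "v < n" "P z = diag_pt q v" using aut_on_diagonal[OF P] on_diagonal_iff by blast
    have "z \<notin> ?\<delta>"
    proof
      assume "z \<in> ?\<delta>"
      then obtain u where "z = const_pt u" by (auto simp: const_pt_def)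
      then show False using z[of 1] z[of 2] const_pt_apply[of 1 u] const_pt_apply[of 2 u] d2 t' by auto
    qed
    then have "P z \<notin> P ` ?\<delta>" using aut_inj[OF P zc] diag_pt_in_cube by auto
    then have nm: "diag_pt q v \<notin> diag_pt s ` {..<n}" using v s by simp
    have "\<pi> t = v \<or> \<pi> t = n - 1 - v"
      using collinear_diag_points[OF v(1) \<pi>(1)[OF t] nm] c v mid[OF t] False by simp
    moreover have "\<pi> t' = v \<or> \<pi> t' = n - 1 - v"
      using collinear_diag_points[OF v(1) \<pi>(1)[OF t'(1)] nm] c v mid[OF t'(1)] t'(3) by simp
    moreover have "\<pi> t \<noteq> \<pi> t'" using inj_on_eq_iff[OF inj, of t t'] t t'(1,2) by simp
    ultimately have "\<pi> t' = n - 1 - \<pi> t" using v(1) by auto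
    then show ?thesis by (simp add: t'_def)
  qed
  have "symmetric_perm n \<pi>" unfolding symmetric_perm_def
    using perm sym by (auto simp: diff_commute)
  then show thesis using that \<pi> by blast
qed


subsection \<open>Automorphisms fixing a main diagonal\<close>

definition ind_pt :: "nat set \<Rightarrow> nat \<Rightarrow> nat \<Rightarrow> nat" where
  "ind_pt A a = (\<lambda>j\<in>{1..d}. if j \<in> A then a else 0)"

definition ind_line :: "nat set \<Rightarrow> (nat \<Rightarrow> nat) set" where
  "ind_line A = line_of A (\<lambda>_. False) (const_pt 0)"

lemma ind_pt_apply: "j \<in> {1..d} \<Longrightarrow> ind_pt A a j = (if j \<in> A then a else 0)"
  by (simp add: ind_pt_def)

lemma ind_pt_in_cube: "a < n \<Longrightarrow> ind_pt A a \<in> cube n d"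
  unfolding ind_pt_def by (rule cube_memI) auto

lemma zero_less_n: "0 < n"
  using n3 by simp

lemma ind_line_eq: "ind_line A = ind_pt A ` {..<n}"
proof -
  have "line_pt A (\<lambda>_. False) (const_pt 0) = ind_pt A"
    by (auto simp: line_pt_def ind_pt_def fun_eq_iff const_pt_apply)
  then show ?thesis by (simp add: ind_line_def line_of_def)
qed

lemma is_line_ind_line: "A \<subseteq> {1..d} \<Longrightarrow> A \<noteq> {} \<Longrightarrow> is_line n d (ind_line A)"
  unfolding ind_line_def using const_pt_in_cube[OF zero_less_n] by (intro is_line_line_of)

lemma active_ind_line: "A \<subseteq> {1..d} \<Longrightarrow> active (ind_line A) = A"
  unfolding ind_line_def by (rule active_line_of)

lemma ind_pt_0: "ind_pt A 0 = const_pt 0"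
  by (auto simp: ind_pt_def const_pt_def diag_pt_def fun_eq_iff)

lemma ind_pt_mem: "a < n \<Longrightarrow> ind_pt A a \<in> ind_line A" "const_pt 0 \<in> ind_line A"
  using zero_less_n ind_pt_0[of A, symmetric] by (auto simp: ind_line_eq)

lemma ind_pt_eq_iff:
  assumes "A \<subseteq> {1..d}" "B \<subseteq> {1..d}" "A \<noteq> {}" "0 < a"
  shows "ind_pt A a = ind_pt B b \<longleftrightarrow> A = B \<and> a = b"
proof
  assume eq: "ind_pt A a = ind_pt B b"
  have *: "(if j \<in> A then a else 0) = (if j \<in> B then b else 0)" if "j \<in> {1..d}" for j
    using eq that by (metis ind_pt_apply)
  obtain k where k: "k \<in> A" using assms by blast
  have ab: "a = b" using *[of k] k assms by (auto split: if_splits)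
  have "j \<in> A \<longleftrightarrow> j \<in> B" if "j \<in> {1..d}" for j
    using *[OF that] ab assms(4) by (auto split: if_splits)
  then show "A = B \<and> a = b" using ab assms(1,2) by blast
qed simp

text \<open>A coordinate can drop to \<open>0\<close> only if \<open>q = 0\<close> or
  \<open>q = n - 1\<close>, and not both occur, so all nonzero coordinates of \<open>z\<close> have
  the same value.\<close>

lemma collinear_const_pt_0:
  assumes "z \<in> cube n d" "collinear z (const_pt 0)" "z \<noteq> const_pt 0"
  obtains B t where "B \<subseteq> {1..d}" "B \<noteq> {}" "0 < t" "t < n" "z = ind_pt B t"
proof -
  note c0 = const_pt_in_cube[OF zero_less_n]
  obtain p q where pq: "p < n" "q < n" "p \<noteq> q"
    "\<And>j. j \<in> {1..d} \<Longrightarrow> z j = const_pt 0 j \<or> (z j = p \<and> const_pt 0 j = q) \<or>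
      (z j = n - 1 - p \<and> const_pt 0 j = n - 1 - q)"
    using colE[OF assms(2,1) c0] by blast
  define B where "B = {j \<in> {1..d}. z j \<noteq> 0}"
  define t where "t = (if q = 0 then p else n - 1 - p)"
  have zt: "z j = t" if "j \<in> B" for j
    using pq(4)[of j] that pq(1-3) n3 by (auto simp: B_def t_def const_pt_apply)
  have "B \<noteq> {}"
  proof
    assume "B = {}"
    then have "z = const_pt 0" using assms c0 by (intro cube_eqI) (auto simp: B_def const_pt_apply)
    then show False using assms by simp
  qed
  then obtain j where j: "j \<in> B" by blast
  then have t: "0 < t" "t < n" using zt[OF j] cube_less[OF assms(1), of j] by (auto simp: B_def)
  have "z = ind_pt B t" using assms(1) t ind_pt_in_cube zt
    by (intro cube_eqI) (auto simp: ind_pt_apply B_def)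
  moreover have "B \<subseteq> {1..d}" by (auto simp: B_def)
  ultimately show thesis using that[of B t] t \<open>B \<noteq> {}\<close> by blast
qed

text \<open>
  If the active set of \<open>g\<close> is nested with that of \<open>L\<close>, the points of \<open>g\<close> and \<open>L\<close> at equal
  positions are collinear. So isolation excludes nested active sets.
\<close>

definition isolated :: "(nat \<Rightarrow> nat) \<Rightarrow> (nat \<Rightarrow> nat) set \<Rightarrow> bool" where
  "isolated z L \<longleftrightarrow> (\<forall>g. is_line n d g \<and> z \<in> g \<and> g \<noteq> L \<longrightarrow>
     (\<exists>y\<in>g - {z}. \<forall>x\<in>L - {z}. \<not> collinear x y))"

lemma isolated_aut:
  assumes P: "P \<in> cube_automorphisms n d" and L: "is_line n d L" and z: "z \<in> cube n d"
    and iso: "isolated z L"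
  shows "isolated (P z) (P ` L)"
  unfolding isolated_def
proof (intro allI impI, elim conjE)
  fix g assume g: "is_line n d g" "P z \<in> g" "g \<noteq> P ` L"
  obtain Q where Q: "Q \<in> cube_automorphisms n d"
    "\<forall>x\<in>cube n d. Q (P x) = x" "\<forall>x\<in>cube n d. P (Q x) = x"
    using aut_inverse[OF P] .
  have gc: "g \<subseteq> cube n d" using g line_sub_cube by blast
  have "P ` Q ` g = g" using Q(3) gc by (force simp: image_iff)
  then have "Q ` g \<noteq> L" using g by blast
  moreover have "z \<in> Q ` g" using g(2) Q(2) z by (metis imageI)
  ultimately obtain y where y: "y \<in> Q ` g - {z}" "\<And>x. x \<in> L - {z} \<Longrightarrow> \<not> collinear x y"
    using iso aut_line[OF Q(1) g(1)] unfolding isolated_def by blast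
  have yc: "y \<in> cube n d" using y(1) gc aut_cube[OF Q(1)] by blast
  have "P y \<in> g - {P z}" using y(1) \<open>P ` Q ` g = g\<close> aut_inj[OF P yc z] by blast
  moreover have "\<not> collinear x' (P y)" if "x' \<in> P ` L - {P z}" for x'
  proof -
    obtain x where x: "x \<in> L - {z}" "x' = P x" using \<open>x' \<in> P ` L - {P z}\<close> by blast
    have "x \<in> cube n d" using x L line_sub_cube by blast
    then show ?thesis using y(2)[OF x(1)] aut_collinear[OF P _ yc] x(2) by simp
  qed
  ultimately show "\<exists>y\<in>g - {P z}. \<forall>x\<in>P ` L - {P z}. \<not> collinear x y" by blast
qed

text \<open>Since \<open>a\<close> is neither \<open>0\<close> nor \<open>n - 1\<close>, no other
  coordinate can move together with \<open>j\<close>, so every line through the point apart from the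
  axis leaves \<open>j\<close> inactive.\<close>

lemma isolated_axis:
  assumes j: "j \<in> {1..d}" and a: "0 < a" "a < n - 1"
  shows "isolated (ind_pt {j} a) (ind_line {j})"
  unfolding isolated_def
proof (intro allI impI, elim conjE)
  let ?z = "ind_pt {j} a"
  fix g assume g: "is_line n d g" "?z \<in> g" "g \<noteq> ind_line {j}"
  have an: "a < n" using a by simp
  have jg: "j \<notin> active g"
  proof
    assume jg: "j \<in> active g"
    obtain s where s: "\<not> s j" "g = line_of (active g) s ?z"
      "\<And>k. k \<in> active g \<Longrightarrow> ?z k = flip (s k) (?z j)"
      using line_at[OF g(1,2) jg] by blast
    have "k = j" if k: "k \<in> active g" for k
    proof (rule ccontr)
      assume "k \<noteq> j"
      moreover have "k \<in> {1..d}" using k active_subset by blast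
      ultimately show False using s(3)[OF k] j a by (auto simp: ind_pt_apply flip_def split: if_splits)
    qed
    then have ag: "active g = {j}" using jg by blast
    have "line_of {j} s ?z = ind_line {j}" unfolding ind_line_def
      using s(1) by (intro line_of_base_cong) (auto simp: ind_pt_apply const_pt_apply)
    then show False using s(2) g(3) unfolding ag by simp
  qed
  obtain i where i: "i \<in> active g" using active_nonempty[OF g(1)] by blast
  then have i': "i \<in> {1..d}" "i \<noteq> j" using active_subset jg by blast+
  \<comment> \<open>Collinearity of \<open>y\<close> with an axis point at height \<open>t\<close>
    would need the pairs \<open>(0, n - 1)\<close> at \<open>i\<close> and \<open>(t, a)\<close> at
    \<open>j\<close> to be equal or mirror images, which the bounds on \<open>a\<close> rule
    out.\<close>
  obtain y where y: "y \<in> g" "y i = n - 1"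
    using line_point_at[OF g(1) i, of "n - 1"] n3 by auto
  have yj: "y j = a" using line_const[OF y(1) g(2) j jg] j by (simp add: ind_pt_apply)
  have yc: "y \<in> cube n d" using y g line_sub_cube by blast
  have "y \<noteq> ?z" using y(2) i' n3 by (auto simp: ind_pt_apply)
  moreover have "\<not> collinear x y" if x: "x \<in> ind_line {j} - {?z}" for x
  proof
    assume c: "collinear x y"
    obtain t where t: "t < n" "x = ind_pt {j} t" using x by (auto simp: ind_line_eq)
    have ta: "t \<noteq> a" using x t by auto
    obtain p q where pq: "p < n" "q < n" "p \<noteq> q"
      "\<And>j. j \<in> {1..d} \<Longrightarrow> x j = y j \<or> (x j = p \<and> y j = q) \<or> (x j = n - 1 - p \<and> y j = n - 1 - q)"
      using colE[OF c _ yc] t ind_pt_in_cube by blast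
    show False
      using pq(4)[OF i'(1)] pq(4)[OF j] i' j yj y(2) t ta a pq(1-3) n3
      by (auto simp: ind_pt_apply)
  qed
  ultimately show "\<exists>y\<in>g - {?z}. \<forall>x\<in>ind_line {j} - {?z}. \<not> collinear x y" using y by blast
qed

text \<open>In each excluded case a second line with nested active set breaks isolation, because its
  points are collinear with those of \<open>ind_line B\<close> at equal positions.\<close>

lemma isolated_imp_axis:
  assumes B: "B \<subseteq> {1..d}" "B \<noteq> {}" and t: "0 < t" "t < n"
    and iso: "isolated (ind_pt B t) (ind_line B)"
  shows "\<exists>i. B = {i} \<and> t \<noteq> n - 1"
proof -
  let ?z = "ind_pt B t"
  have zc: "?z \<in> cube n d" using t ind_pt_in_cube by simp
  obtain i where i: "i \<in> B" "i \<in> {1..d}" using B by blast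
  have Bi: "B = {i}"
  proof (rule ccontr)
    assume "B \<noteq> {i}"
    define g where "g = line_of {i} (\<lambda>_. False) ?z"
    have lg: "is_line n d g" using i zc unfolding g_def by (intro is_line_line_of) auto
    have "active g = {i}" using i unfolding g_def by (intro active_line_of) auto
    then have "g \<noteq> ind_line B" using active_ind_line[OF B(1)] \<open>B \<noteq> {i}\<close> by metis
    moreover have "?z \<in> g"
      using i t zc unfolding g_def by (intro line_of_self[of _ _ _ t]) (auto simp: ind_pt_apply)
    ultimately obtain y where y: "y \<in> g - {?z}" "\<And>x. x \<in> ind_line B - {?z} \<Longrightarrow> \<not> collinear x y"
      using iso lg unfolding isolated_def by blast
    obtain u where u: "u < n" "y = line_pt {i} (\<lambda>_. False) ?z u"
      using y(1) unfolding g_def line_of_def by blast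
    have yj: "y j = (if j = i then u else if j \<in> B then t else 0)" if "j \<in> {1..d}" for j
      using that u by (simp add: line_pt_apply ind_pt_apply)
    have yc: "y \<in> cube n d" using u zc line_pt_in_cube by simp
    have "u \<noteq> t"
    proof
      assume "u = t"
      then have "y = ?z" using yj i by (intro cube_eqI[OF yc zc]) (auto simp: ind_pt_apply)
      then show False using y(1) by blast
    qed
    have "collinear (ind_pt B u) y"
      by (rule colI[of _ _ u t])
        (use u t \<open>u \<noteq> t\<close> ind_pt_in_cube yc i yj in \<open>auto simp: ind_pt_apply\<close>)
    moreover have "ind_pt B u \<noteq> ?z"
      using \<open>u \<noteq> t\<close> i ind_pt_apply[OF i(2), of B u] ind_pt_apply[OF i(2), of B t] by auto
    ultimately show False using y(2)[of "ind_pt B u"] u by (simp add: ind_line_eq)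
  qed
  moreover have "t \<noteq> n - 1"
  proof
    assume tn: "t = n - 1"
    \<comment> \<open>The end of an axis is a corner of the cube, so the main diagonal with all
      coordinates other than \<open>i\<close> reflected passes through it.\<close>
    define s where "s j = (j \<noteq> i)" for j
    define g where "g = diag_pt s ` {..<n}"
    have lg: "is_line n d g" "active g = {1..d}"
      using maindiag_diag_pt[of s] by (simp_all add: g_def maindiag_def)
    obtain k where k: "k \<in> {1..d}" "k \<noteq> i" by (rule exists_other_coordinate)
    then have "active g \<noteq> active (ind_line B)" using lg active_ind_line[OF B(1)] Bi by auto
    moreover have "?z = diag_pt s t" using t Bi tn
      by (intro cube_eqI zc diag_pt_in_cube) (auto simp: ind_pt_apply diag_pt_apply s_def flip_def)
    then have "?z \<in> g" using t by (simp add: g_def)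
    ultimately obtain y where y: "y \<in> g - {?z}" "\<And>x. x \<in> ind_line B - {?z} \<Longrightarrow> \<not> collinear x y"
      using iso lg unfolding isolated_def by blast
    obtain u where u: "u < n" "y = diag_pt s u" using y(1) by (auto simp: g_def)
    have "u \<noteq> t" using y(1) u \<open>?z = diag_pt s t\<close> by auto
    have "collinear (ind_pt B u) y"
      by (rule colI[of _ _ "n - 1" u])
        (use u tn t \<open>u \<noteq> t\<close> ind_pt_in_cube diag_pt_in_cube Bi in \<open>auto simp: ind_pt_apply diag_pt_apply s_def flip_def\<close>)
    moreover have "ind_pt B u \<noteq> ?z"
      using \<open>u \<noteq> t\<close> i ind_pt_apply[OF i(2), of B u] ind_pt_apply[OF i(2), of B t] by auto
    ultimately show False using y(2)[of "ind_pt B u"] u by (simp add: ind_line_eq)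
  qed
  ultimately show ?thesis by blast
qed

text \<open>Collinearity with the origin makes the image a point \<open>t\<close> on
  \<open>B\<close>, isolation reduces \<open>B\<close> to one coordinate, and collinearity with the
  fixed point \<open>const_pt a\<close> recovers the height \<open>t = a\<close>.\<close>

lemma aut_axis_point:
  assumes Q: "Q \<in> cube_automorphisms n d" and fixd: "\<forall>t<n. Q (const_pt t) = const_pt t"
    and j: "j \<in> {1..d}" and a: "0 < a" "a < n - 1"
  shows "\<exists>i\<in>{1..d}. Q (ind_pt {j} a) = ind_pt {i} a"
proof -
  let ?x = "ind_pt {j} a" and ?z = "Q (ind_pt {j} a)"
  have an: "a < n" using a by simp
  have xc: "?x \<in> cube n d" using an ind_pt_in_cube by blast
  note c0 = const_pt_in_cube[OF zero_less_n]
  have f0: "Q (const_pt 0) = const_pt 0" using fixd zero_less_n by blast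
  have lj: "is_line n d (ind_line {j})" using j is_line_ind_line by simp
  have zc: "?z \<in> cube n d" using aut_cube[OF Q xc] .
  have "collinear ?x (const_pt 0)" using lj ind_pt_mem an unfolding collinear_def by blast
  then have "collinear ?z (const_pt 0)" using aut_collinear[OF Q xc c0] f0 by simp
  moreover have xz: "?x \<noteq> const_pt 0" using ind_pt_apply[OF j, of "{j}" a] const_pt_apply[OF j, of 0] a by auto
  then have z0: "?z \<noteq> const_pt 0" using aut_inj[OF Q xc c0] f0 by simp
  ultimately obtain B t where B: "B \<subseteq> {1..d}" "B \<noteq> {}" "0 < t" "t < n" "?z = ind_pt B t"
    using collinear_const_pt_0[OF zc] by blast
  have "Q ` ind_line {j} = ind_line B"
  proof (rule line_unique[of _ _ "const_pt 0" ?z])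
    show "is_line n d (Q ` ind_line {j})" using aut_line[OF Q lj] .
    show "is_line n d (ind_line B)" using is_line_ind_line B by blast
    show "const_pt 0 \<in> Q ` ind_line {j}" using imageI[OF ind_pt_mem(2), of Q "{j}"] f0 by simp
    show "?z \<in> Q ` ind_line {j}" using ind_pt_mem(1)[OF an] by blast
    show "?z \<in> ind_line B" unfolding B(5) using ind_pt_mem(1) B by blast
  qed (use ind_pt_mem z0 in auto)
  then have "isolated (ind_pt B t) (ind_line B)"
    using isolated_aut[OF Q lj xc isolated_axis[OF j a]] B by simp
  then obtain i where i: "B = {i}" "t \<noteq> n - 1" using isolated_imp_axis B by blast
  have ii: "i \<in> {1..d}" using i B by simp
  obtain k where k: "k \<in> {1..d}" "k \<noteq> i" by (rule exists_other_coordinate)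
  have ca: "const_pt a \<in> cube n d" using an const_pt_in_cube by blast
  have "collinear ?x (const_pt a)"
    by (rule colI[of _ _ 0 a]) (use xc ca a n3 in \<open>auto simp: ind_pt_apply const_pt_apply\<close>)
  then have "collinear (ind_pt B t) (const_pt a)" using aut_collinear[OF Q xc ca] fixd an B by simp
  then obtain p q where pq: "p < n" "q < n" "p \<noteq> q"
      "\<And>j. j \<in> {1..d} \<Longrightarrow> ind_pt B t j = const_pt a j \<or> (ind_pt B t j = p \<and> const_pt a j = q) \<or>
        (ind_pt B t j = n - 1 - p \<and> const_pt a j = n - 1 - q)"
    using colE[OF _ _ ca] ind_pt_in_cube[OF B(4)] by blast
  \<comment> \<open>Coordinate \<open>k\<close> uses the pair \<open>(0, a)\<close>; were
    \<open>t\<close> different from \<open>a\<close>, the pair \<open>(t, a)\<close> would equal it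
    or its mirror image, giving \<open>t = 0\<close> or \<open>t = n - 1\<close>.\<close>
  have "ind_pt B t i = t" "ind_pt B t k = 0" "const_pt a i = a" "const_pt a k = a"
    using ii k i by (simp_all add: ind_pt_apply const_pt_apply)
  then have "t = a" using pq(4)[OF ii] pq(4)[OF k(1)] pq(1-3) i(2) B(3,4) a by auto
  then show ?thesis using B i ii by blast
qed

section \<open>Rigidity of automorphisms\<close>

lemma aut_fixes_line:
  assumes "R \<in> cube_automorphisms n d" "is_line n d L" "x \<in> L" "y \<in> L" "x \<noteq> y" "R x = x" "R y = y"
  shows "R ` L = L"
  using assms aut_line[OF assms(1,2)] by (intro line_unique[of _ _ x y]) force+

lemma aut_fixes_last:
  assumes R: "R \<in> cube_automorphisms n d" and L: "is_line n d L" "R ` L = L"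
    and "w \<in> L" "\<And>x. x \<in> L \<Longrightarrow> x \<noteq> w \<Longrightarrow> R x = x"
  shows "R w = w"
proof (rule ccontr)
  assume "R w \<noteq> w"
  moreover have "R w \<in> L" using assms by blast
  ultimately have "R (R w) = R w" using assms by blast
  then show False using aut_inj[OF R] \<open>R w \<in> L\<close> \<open>R w \<noteq> w\<close> assms line_sub_cube by blast
qed

text \<open>Collinearity with axis points at height \<open>a\<close> lets \<open>B\<close> and
  \<open>t\<close> be recovered: another coordinate \<open>k\<close> of \<open>B\<close> carries the
  pair \<open>(t, 0)\<close>, which cannot occur at \<open>j\<close>, even mirrored, since
  \<open>a\<close> is neither \<open>0\<close> nor \<open>n - 1\<close>.\<close>

lemma collinear_ind_pt_axis:
  assumes "B \<subseteq> {1..d}" "B \<noteq> {}" "0 < t" "t < n" "j \<in> {1..d}" "0 < a" "a < n - 1"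
    "collinear (ind_pt B t) (ind_pt {j} a)"
  shows "j \<in> B \<and> (t = a \<or> B = {j})"
proof -
  have an: "a < n" using assms(7) by simp
  obtain p q where pq: "p < n" "q < n" "p \<noteq> q"
      "\<And>k. k \<in> {1..d} \<Longrightarrow> ind_pt B t k = ind_pt {j} a k \<or> (ind_pt B t k = p \<and> ind_pt {j} a k = q) \<or>
        (ind_pt B t k = n - 1 - p \<and> ind_pt {j} a k = n - 1 - q)"
    using colE[OF assms(8) ind_pt_in_cube[OF assms(4)] ind_pt_in_cube[OF an]] by blast
  show ?thesis
  proof (cases "\<exists>k\<in>B. k \<noteq> j")
    case True
    then obtain k where k: "k \<in> B" "k \<noteq> j" "k \<in> {1..d}" using assms by blast
    show ?thesis using pq(4)[OF k(3)] pq(4)[OF assms(5)] k pq(1-3) assms(3-7)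
      by (auto simp: ind_pt_apply split: if_splits)
  next
    case False
    then have "B = {j}" using assms(2) by auto
    then show ?thesis by simp
  qed
qed

lemma aut_rigid:
  assumes R: "R \<in> cube_automorphisms n d" and fixd: "\<forall>t<n. R (const_pt t) = const_pt t"
    and fixe: "\<forall>j\<in>{1..d}. R (ind_pt {j} 1) = ind_pt {j} 1"
    and x: "x \<in> cube n d"
  shows "R x = x"
proof -
  have f0: "R (const_pt 0) = const_pt 0" using fixd zero_less_n by blast
  have axis: "R (ind_pt {j} a) = ind_pt {j} a" if j: "j \<in> {1..d}" and a: "0 < a" "a < n - 1" for j a
  proof -
    have lj: "is_line n d (ind_line {j})" using j is_line_ind_line by simp
    have "ind_pt {j} 1 \<noteq> const_pt 0" using ind_pt_apply[OF j, of "{j}" 1] const_pt_apply[OF j, of 0] by auto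
    then have "R ` ind_line {j} = ind_line {j}"
      using fixe f0 j n3 ind_pt_mem by (intro aut_fixes_line[OF R lj, of "ind_pt {j} 1" "const_pt 0"]) auto
    moreover obtain i where i: "i \<in> {1..d}" "R (ind_pt {j} a) = ind_pt {i} a"
      using aut_axis_point[OF R fixd j a] by blast
    moreover have "ind_pt {j} a \<in> ind_line {j}" using a ind_pt_mem by simp
    ultimately have "ind_pt {i} a \<in> ind_line {j}" by (metis imageI)
    then obtain u where "ind_pt {i} a = ind_pt {j} u" by (auto simp: ind_line_eq)
    then have "i = j" using ind_pt_eq_iff[of "{i}" "{j}" a u] i j a by auto
    then show ?thesis using i by simp
  qed
  \<comment> \<open>The axis points at height \<open>a\<close> are fixed, so the image is collinear
    with the same ones as the point itself. When \<open>A\<close> has several elements, these are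
    the ones on coordinates of \<open>A\<close>, and they determine the image.\<close>
  have mid: "R (ind_pt A a) = ind_pt A a" if A: "A \<subseteq> {1..d}" "A \<noteq> {}" and a: "0 < a" "a < n - 1" for A a
  proof (cases "\<exists>j. A = {j}")
    case True
    then show ?thesis using axis A a by auto
  next
    case False
    let ?x = "ind_pt A a"
    have an: "a < n" using a by simp
    have xc: "?x \<in> cube n d" using ind_pt_in_cube[OF an] .
    have zc: "R ?x \<in> cube n d" using aut_cube[OF R xc] .
    note c0 = const_pt_in_cube[OF zero_less_n]
    have "collinear ?x (const_pt 0)" using is_line_ind_line[OF A] ind_pt_mem an unfolding collinear_def by blast
    then have "collinear (R ?x) (const_pt 0)" using aut_collinear[OF R xc c0] f0 by simp
    moreover have "?x \<noteq> const_pt 0" using ind_pt_eq_iff[of A A a 0] A a ind_pt_0[of A] by auto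
    then have "R ?x \<noteq> const_pt 0" using aut_inj[OF R xc c0] f0 by simp
    ultimately obtain B t where B: "B \<subseteq> {1..d}" "B \<noteq> {}" "0 < t" "t < n" "R ?x = ind_pt B t"
      using collinear_const_pt_0[OF zc] by blast
    have collinear_eq: "collinear (ind_pt B t) (ind_pt {j} a) \<longleftrightarrow> collinear ?x (ind_pt {j} a)" if "j \<in> {1..d}" for j
      using aut_collinear[OF R xc ind_pt_in_cube[OF an], of "{j}"] axis[OF that a] B(5) by simp
    have collinear_mem: "collinear (ind_pt C a) (ind_pt {j} a)" if "C \<subseteq> {1..d}" "j \<in> C" for C j
      by (rule colI[of _ _ a 0]) (use that ind_pt_in_cube an a in \<open>auto simp: ind_pt_apply\<close>)
    have AB: "j \<in> B \<and> (t = a \<or> B = {j})" if "j \<in> A" for j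
    proof -
      have "j \<in> {1..d}" using that A by blast
      then show ?thesis using collinear_ind_pt_axis[OF B(1-4) _ a] collinear_eq collinear_mem[OF A(1) that] by blast
    qed
    \<comment> \<open>Two coordinates are needed because \<open>B\<close> cannot equal both
      \<open>{j}\<close> and \<open>{k}\<close>.\<close>
    obtain j k where jk: "j \<in> A" "k \<in> A" "j \<noteq> k" using A False by blast
    have ta: "t = a" using AB[OF jk(1)] AB[OF jk(2)] jk(3) by auto
    have "B \<subseteq> A"
    proof
      fix j assume j: "j \<in> B"
      then have "j \<in> {1..d}" using B by blast
      then show "j \<in> A"
        using collinear_ind_pt_axis[OF A a(1) an _ a] collinear_eq collinear_mem[OF B(1) j] ta by blast
    qed
    then have "A = B" using AB by blast
    then show ?thesis using B ta by simp
  qed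
  have all: "R (ind_pt A a) = ind_pt A a" if A: "A \<subseteq> {1..d}" and a: "a < n" for A a
  proof -
    consider "A = {} \<or> a = 0" | "A \<noteq> {}" "0 < a" "a < n - 1" | "A \<noteq> {}" "a = n - 1"
      using a by linarith
    then show ?thesis
    proof cases
      case 1
      then have "ind_pt A a = const_pt 0" using ind_pt_0 by (auto simp: ind_pt_def)
      then show ?thesis using f0 by simp
    next
      case 2
      then show ?thesis using mid A by blast
    next
      case 3
      \<comment> \<open>The height \<open>n - 1\<close> escapes the previous argument, but it is the
        last point of an invariant line whose other points are fixed.\<close>
      have l: "is_line n d (ind_line A)" using is_line_ind_line A 3 by blast
      have 1: "R (ind_pt A 1) = ind_pt A 1" using mid[of A 1] A 3 n3 by auto
      have ne: "ind_pt A 1 \<noteq> const_pt 0" using ind_pt_eq_iff[of A A 1 0] A 3 ind_pt_0[of A] by auto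
      have "R ` ind_line A = ind_line A"
        using 1 f0 n3 ind_pt_mem ne by (intro aut_fixes_line[OF R l, of "ind_pt A 1" "const_pt 0"]) auto
      then show ?thesis
      proof (rule aut_fixes_last[OF R l])
        show "ind_pt A a \<in> ind_line A" using a ind_pt_mem by simp
        fix y assume y: "y \<in> ind_line A" "y \<noteq> ind_pt A a"
        then obtain u where u: "u < n" "y = ind_pt A u" by (auto simp: ind_line_eq)
        then have "u \<noteq> n - 1" using y 3 by blast
        then have "u = 0 \<or> (0 < u \<and> u < n - 1)" using u(1) by linarith
        then show "R y = y" using mid A 3 u f0 ind_pt_0 by auto
      qed
    qed
  qed
  show ?thesis using x
  proof (induction "card (x ` {1..d} - {0})" arbitrary: x rule: less_induct)
    case less
    let ?V = "x ` {1..d} - {0}"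
    let ?A = "\<lambda>v. {j \<in> {1..d}. x j = v}"
    let ?F = "\<lambda>_::nat. False"
    show ?case
    proof (cases "\<exists>v\<in>?V. \<exists>w\<in>?V. v \<noteq> w")
      case False
      have "\<exists>t<n. \<forall>v\<in>?V. v = t"
      proof (cases "?V = {}")
        case True
        then show ?thesis using zero_less_n by blast
      next
        case ne: False
        then obtain t where t: "t \<in> ?V" by blast
        then have "t < n" using cube_less[OF less.prems] by auto
        then show ?thesis using False t by blast
      qed
      then obtain t where t: "t < n" "\<forall>v\<in>?V. v = t" by blast
      have eq: "x = ind_pt {j \<in> {1..d}. x j \<noteq> 0} t"
        using less.prems t ind_pt_in_cube by (intro cube_eqI) (auto simp: ind_pt_apply)
      have "R x = R (ind_pt {j \<in> {1..d}. x j \<noteq> 0} t)" by (rule arg_cong[OF eq])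
      also have "\<dots> = ind_pt {j \<in> {1..d}. x j \<noteq> 0} t" using t(1) by (intro all) auto
      also have "\<dots> = x" by (rule eq[symmetric])
      finally show ?thesis .
    next
      case True
      have fin: "finite ?V" by simp
      \<comment> \<open>Moving all coordinates with value \<open>v\<close> simultaneously yields a line that passes through
        two points with fewer nonzero values, obtained for \<open>0\<close> and \<open>w\<close>.\<close>
      have key: "x \<in> line_of (?A v) ?F x \<and> R x \<in> line_of (?A v) ?F x \<and> is_line n d (line_of (?A v) ?F x)"
        if v: "v \<in> ?V" and w: "w \<in> ?V" and vw: "v \<noteq> w" for v w
      proof -
        have vn: "v < n" "w < n" using v w cube_less[OF less.prems] by auto
        obtain i where i: "i \<in> ?A v" using v by auto
        have l: "is_line n d (line_of (?A v) ?F x)"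
          using less.prems i by (intro is_line_line_of) auto
        have fixed: "R (line_pt (?A v) ?F x u) = line_pt (?A v) ?F x u" if u: "u = 0 \<or> u = w" for u
        proof (rule less.hyps)
          have un: "u < n" using u vn n3 by auto
          show "line_pt (?A v) ?F x u \<in> cube n d" using less.prems un line_pt_in_cube by blast
          have "line_pt (?A v) ?F x u ` {1..d} - {0} \<subseteq> ?V - {v}"
          proof
            fix y assume "y \<in> line_pt (?A v) ?F x u ` {1..d} - {0}"
            then obtain j where "j \<in> {1..d}" "y = (if x j = v then u else x j)" "y \<noteq> 0"
              by (auto simp: line_pt_apply)
            then show "y \<in> ?V - {v}" using u w vw by (cases "x j = v") auto
          qed
          also have "?V - {v} \<subset> ?V" using v by blast
          finally have "line_pt (?A v) ?F x u ` {1..d} - {0} \<subset> ?V" .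
          then show "card (line_pt (?A v) ?F x u ` {1..d} - {0}) < card ?V"
            using fin by (rule psubset_card_mono[rotated])
        qed
        have xm: "x \<in> line_of (?A v) ?F x"
          using less.prems vn by (intro line_of_self[of _ _ _ v]) auto
        have "line_pt (?A v) ?F x 0 i \<noteq> line_pt (?A v) ?F x w i" using i w by (auto simp: line_pt_apply)
        then have "R ` line_of (?A v) ?F x = line_of (?A v) ?F x"
          using vn n3 fixed
          by (intro aut_fixes_line[OF R l, of "line_pt (?A v) ?F x 0" "line_pt (?A v) ?F x w"])
            (auto simp: line_of_def)
        then show ?thesis using xm l by blast
      qed
      obtain v w where vw: "v \<in> ?V" "w \<in> ?V" "v \<noteq> w" using True by blast
      \<comment> \<open>\<open>R x\<close> lies on the line that moves the coordinates of value
        \<open>v\<close> and on the one that moves those of value \<open>w\<close>. Coordinate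
        \<open>j\<close> has value \<open>v\<close>, so it is constant on the second line and
        separates the points of the first.\<close>
      note k1 = key[OF vw] and k2 = key[OF vw(2,1) vw(3)[symmetric]]
      obtain j where j: "j \<in> {1..d}" "x j = v" using vw by auto
      have "active (line_of (?A w) ?F x) = ?A w" by (rule active_line_of) auto
      then have "j \<notin> active (line_of (?A w) ?F x)" using j(2) vw(3) by simp
      then have eq: "R x j = x j"
        using line_const[OF conjunct1[OF conjunct2[OF k2]] conjunct1[OF k2] j(1)] by blast
      have "active (line_of (?A v) ?F x) = ?A v" by (rule active_line_of) auto
      then have "j \<in> active (line_of (?A v) ?F x)" using j by simp
      then show ?thesis using line_point_eq[of _ "R x" x j] k1 eq by blast
    qed
  qed
qed

lemma aut_fixing_diagonal:
  assumes Q: "Q \<in> cube_automorphisms n d" and fixd: "\<forall>t<n. Q (const_pt t) = const_pt t"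
  obtains \<sigma> where "\<sigma> permutes {1..d}" "\<forall>x\<in>cube n d. Q x = signed_perm_map \<sigma> (\<lambda>_. False) x"
proof -
  let ?F = "\<lambda>_::nat. False"
  have "\<forall>j\<in>{1..d}. \<exists>i\<in>{1..d}. Q (ind_pt {j} 1) = ind_pt {i} 1"
    using aut_axis_point[OF Q fixd] n3 by auto
  then obtain f where f: "\<And>j. j \<in> {1..d} \<Longrightarrow> f j \<in> {1..d} \<and> Q (ind_pt {j} 1) = ind_pt {f j} 1"
    by metis
  define \<tau> where "\<tau> j = (if j \<in> {1..d} then f j else j)" for j
  have \<tau>: "\<tau> j \<in> {1..d}" "Q (ind_pt {j} 1) = ind_pt {\<tau> j} 1" if "j \<in> {1..d}" for j
    using f that by (auto simp: \<tau>_def)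
  have ic: "ind_pt A 1 \<in> cube n d" for A using n3 ind_pt_in_cube by simp
  have "inj_on \<tau> {1..d}"
  proof (rule inj_onI)
    fix i j assume ij: "i \<in> {1..d}" "j \<in> {1..d}" "\<tau> i = \<tau> j"
    then have "ind_pt {i} 1 = ind_pt {j} 1" using \<tau> aut_inj[OF Q ic ic] by metis
    then show "i = j" using ind_pt_eq_iff[of "{i}" "{j}" 1 1] ij by auto
  qed
  then have "bij_betw \<tau> {1..d} {1..d}"
    using endo_inj_surj[of "{1..d}" \<tau>] \<tau>(1) by (simp add: bij_betw_def image_subset_iff)
  then have perm: "\<tau> permutes {1..d}" by (rule bij_imp_permutes) (auto simp: \<tau>_def)
  \<comment> \<open>Pulling back along \<open>\<tau>\<close> sends the axis point of
    \<open>\<tau> j\<close> to that of \<open>j\<close>, so \<open>?N\<close> undoes the action of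
    \<open>Q\<close> on the edges; the permutation for \<open>Q\<close> itself is the inverse of
    \<open>\<tau>\<close>.\<close>
  let ?N = "signed_perm_map \<tau> ?F"
  define R where "R = compose (cube n d) ?N Q"
  have N: "?N \<in> cube_automorphisms n d" using signed_perm_map_aut[OF perm] .
  have R: "R \<in> cube_automorphisms n d" unfolding R_def using aut_compose[OF N Q] .
  have Rx: "R x = ?N (Q x)" if "x \<in> cube n d" for x using that by (simp add: R_def compose_eq)
  have R1: "R (const_pt t) = const_pt t" if t: "t < n" for t
  proof (rule cube_eqI)
    show "R (const_pt t) \<in> cube n d" using aut_cube[OF R] const_pt_in_cube t by blast
    fix j assume j: "j \<in> {1..d}"
    then show "R (const_pt t) j = const_pt t j"
      using t fixd \<tau>(1)[OF j] by (simp add: Rx const_pt_in_cube signed_perm_map_apply const_pt_apply)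
  qed (use t const_pt_in_cube in auto)
  have R2: "R (ind_pt {j} 1) = ind_pt {j} 1" if j: "j \<in> {1..d}" for j
  proof (rule cube_eqI)
    show "R (ind_pt {j} 1) \<in> cube n d" using aut_cube[OF R ic] .
    fix k assume k: "k \<in> {1..d}"
    have "\<tau> k = \<tau> j \<longleftrightarrow> k = j" using permutes_inj[OF perm] by (simp add: inj_eq)
    then show "R (ind_pt {j} 1) k = ind_pt {j} 1 k"
      using k \<tau>[OF j] \<tau>(1)[OF k] by (simp add: Rx ic signed_perm_map_apply ind_pt_apply del: One_nat_def)
  qed (rule ic)
  have id: "?N (Q x) = x" if "x \<in> cube n d" for x
    using aut_rigid[OF R] R1 R2 Rx that by metis
  define \<sigma> where "\<sigma> = inv_into UNIV \<tau>"
  have \<sigma>: "\<sigma> permutes {1..d}" unfolding \<sigma>_def using permutes_inv[OF perm] .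
  have "Q x = signed_perm_map \<sigma> ?F x" if x: "x \<in> cube n d" for x
  proof (rule cube_eqI)
    show Qx: "Q x \<in> cube n d" using aut_cube[OF Q x] .
    show "signed_perm_map \<sigma> ?F x \<in> cube n d" using signed_perm_map_in_cube[OF \<sigma> x] .
    fix j assume j: "j \<in> {1..d}"
    have sj: "\<sigma> j \<in> {1..d}" "\<tau> (\<sigma> j) = j"
      using j permutes_in_image[OF \<sigma>] permutes_inverses(1)[OF perm] by (auto simp: \<sigma>_def)
    have "x (\<sigma> j) = ?N (Q x) (\<sigma> j)" using id[OF x] by simp
    also have "\<dots> = Q x j" using sj Qx by (simp add: signed_perm_map_apply)
    finally show "Q x j = signed_perm_map \<sigma> ?F x j" using x j by (simp add: signed_perm_map_apply)
  qed
  then show thesis using that \<sigma> by blast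
qed

section \<open>Normal form of an automorphism\<close>

definition std_map :: "(nat \<Rightarrow> nat) \<Rightarrow> (nat \<Rightarrow> bool) \<Rightarrow> (nat \<Rightarrow> nat) \<Rightarrow> (nat \<Rightarrow> nat) \<Rightarrow> (nat \<Rightarrow> nat)" where
  "std_map \<sigma> s \<pi> = compose (cube n d) (signed_perm_map \<sigma> s) (coord_map n d \<pi>)"

lemma std_map_aut:
  "\<sigma> permutes {1..d} \<Longrightarrow> symmetric_perm n \<pi> \<Longrightarrow> std_map \<sigma> s \<pi> \<in> cube_automorphisms n d"
  unfolding std_map_def by (intro aut_compose signed_perm_map_aut coord_map_aut)

lemma std_map_apply:
  assumes "\<sigma> permutes {1..d}" "symmetric_perm n \<pi>" "x \<in> cube n d" "j \<in> {1..d}"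
  shows "std_map \<sigma> s \<pi> x j = flip (s j) (\<pi> (x (\<sigma> j)))"
proof -
  have "\<sigma> j \<in> {1..d}" using permutes_in_image[OF assms(1)] assms(4) by blast
  then show ?thesis using assms
    by (simp add: std_map_def compose_eq signed_perm_map_apply coord_map_in_cube coord_map_apply)
qed

lemma aut_eqI:
  assumes "P \<in> cube_automorphisms n d" "Q \<in> cube_automorphisms n d"
    "\<And>x j. x \<in> cube n d \<Longrightarrow> j \<in> {1..d} \<Longrightarrow> P x j = Q x j"
  shows "P = Q"
proof (rule extensionalityI)
  show "P \<in> extensional (cube n d)" "Q \<in> extensional (cube n d)"
    using assms by (auto simp: cube_automorphisms_def Bij_def)
  fix x assume x: "x \<in> cube n d"
  show "P x = Q x" using assms x aut_cube by (intro cube_eqI) auto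
qed

text \<open>\<open>T\<close> imitates \<open>P\<close> on the main diagonal, so composing with its
  inverse leaves an automorphism that fixes this diagonal pointwise, which is a permutation of the
  coordinates.\<close>

theorem aut_std_map:
  assumes P: "P \<in> cube_automorphisms n d"
  obtains \<sigma> s \<pi> where "\<sigma> permutes {1..d}" "symmetric_perm n \<pi>" "P = std_map \<sigma> s \<pi>"
proof -
  obtain s \<pi> where \<pi>: "symmetric_perm n \<pi>" "\<forall>t<n. P (const_pt t) = diag_pt s (\<pi> t)"
    using aut_diagonal_form[OF P] .
  define T where "T = std_map id s \<pi>"
  have id: "id permutes {1..d}" by (rule permutes_id)
  have T: "T \<in> cube_automorphisms n d" unfolding T_def using std_map_aut[OF id \<pi>(1)] .
  obtain T' where T': "T' \<in> cube_automorphisms n d"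
    "\<forall>x\<in>cube n d. T' (T x) = x" "\<forall>x\<in>cube n d. T (T' x) = x"
    using aut_inverse[OF T] .
  define Q where "Q = compose (cube n d) T' P"
  have Q: "Q \<in> cube_automorphisms n d" unfolding Q_def using aut_compose[OF T'(1) P] .
  have Qx: "Q x = T' (P x)" if "x \<in> cube n d" for x using that by (simp add: Q_def compose_eq)
  have "T (const_pt t) = diag_pt s (\<pi> t)" if t: "t < n" for t
    using t symmetric_perm_less[OF \<pi>(1)] const_pt_in_cube aut_cube[OF T] diag_pt_in_cube std_map_apply[OF id \<pi>(1)]
    by (intro cube_eqI) (auto simp: T_def diag_pt_apply const_pt_apply)
  then have "\<forall>t<n. Q (const_pt t) = const_pt t" using Qx const_pt_in_cube \<pi>(2) T'(2) by metis
  then obtain \<sigma> where \<sigma>: "\<sigma> permutes {1..d}" "\<forall>x\<in>cube n d. Q x = signed_perm_map \<sigma> (\<lambda>_. False) x"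
    using aut_fixing_diagonal[OF Q] by blast
  have "P = std_map \<sigma> s \<pi>"
  proof (rule aut_eqI[OF P std_map_aut[OF \<sigma>(1) \<pi>(1)]])
    fix x j assume x: "x \<in> cube n d" and j: "j \<in> {1..d}"
    have "P x = T (Q x)" using Qx[OF x] T'(3) aut_cube[OF P x] by simp
    then have "P x j = flip (s j) (\<pi> (Q x j))"
      using std_map_apply[OF id \<pi>(1) aut_cube[OF Q x] j] by (simp add: T_def)
    also have "\<dots> = std_map \<sigma> s \<pi> x j"
      using std_map_apply[OF \<sigma>(1) \<pi>(1) x j] \<sigma>(2) x j by (simp add: signed_perm_map_apply)
    finally show "P x j = std_map \<sigma> s \<pi> x j" .
  qed
  then show thesis using that \<sigma>(1) \<pi>(1) by blast
qed


subsection \<open>Generators\<close>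

lemma signed_perm_map_eqI:
  assumes "\<sigma> permutes {1..d}" "P \<in> extensional (cube n d)"
    "\<And>x. x \<in> cube n d \<Longrightarrow> P x \<in> extensional {1..d}"
    "\<And>x j. x \<in> cube n d \<Longrightarrow> j \<in> {1..d} \<Longrightarrow> P x j = flip (s j) (x (\<sigma> j))"
  shows "P = signed_perm_map \<sigma> s"
proof (rule extensionalityI[OF assms(2)])
  show "signed_perm_map \<sigma> s \<in> extensional (cube n d)" by (simp add: signed_perm_map_def)
  fix x assume x: "x \<in> cube n d"
  show "P x = signed_perm_map \<sigma> s x"
    using assms(3)[OF x]
    by (rule extensionalityI) (use x assms(4) in \<open>auto simp: signed_perm_map_def\<close>)
qed

lemma rot_eq:
  assumes "i \<in> {1..d}" "j \<in> {1..d}" "i \<noteq> j"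
  shows "rot n d i j = signed_perm_map (Transposition.transpose i j) (\<lambda>k. k = i)"
proof (rule signed_perm_map_eqI)
  show "Transposition.transpose i j permutes {1..d}" using assms(1,2) by (rule permutes_swap_id)
  show "rot n d i j x \<in> extensional {1..d}" if "x \<in> cube n d" for x
    using that assms by (auto simp: rot_def cube_def extensional_def PiE_def)
  show "rot n d i j x k = flip (k = i) (x (Transposition.transpose i j k))"
    if "x \<in> cube n d" "k \<in> {1..d}" for x k
    using that assms by (auto simp: rot_def flip_def Transposition.transpose_def)
qed (simp add: rot_def)

lemma swap_last_eq:
  "swap_last n d = signed_perm_map (Transposition.transpose (d - 1) d) (\<lambda>_. False)"
proof (rule signed_perm_map_eqI)
  have dd: "d - 1 \<in> {1..d}" "d \<in> {1..d}" using d2 by auto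
  show "Transposition.transpose (d - 1) d permutes {1..d}" using dd by (rule permutes_swap_id)
  show "swap_last n d x \<in> extensional {1..d}" if "x \<in> cube n d" for x
    using that dd by (auto simp: swap_last_def cube_def extensional_def PiE_def)
  show "swap_last n d x k = flip False (x (Transposition.transpose (d - 1) d k))"
    if "x \<in> cube n d" "k \<in> {1..d}" for x k
    using that by (auto simp: swap_last_def Transposition.transpose_def)
qed (simp add: swap_last_def)

lemma id_eq_signed_perm_map: "(\<lambda>x\<in>cube n d. x) = signed_perm_map id (\<lambda>_. False)"
  by (rule signed_perm_map_eqI) (auto simp: permutes_id cube_def PiE_def)

lemma signed_perm_map_compose:
  assumes "\<sigma> permutes {1..d}" "\<sigma>' permutes {1..d}"
  shows "compose (cube n d) (signed_perm_map \<sigma> s) (signed_perm_map \<sigma>' s')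
    = signed_perm_map (\<sigma>' \<circ> \<sigma>) (\<lambda>j. s j \<noteq> s' (\<sigma> j))"
proof (rule signed_perm_map_eqI)
  show "\<sigma>' \<circ> \<sigma> permutes {1..d}" using assms permutes_compose by blast
  fix x assume x: "x \<in> cube n d"
  have c: "compose (cube n d) (signed_perm_map \<sigma> s) (signed_perm_map \<sigma>' s') x
    = signed_perm_map \<sigma> s (signed_perm_map \<sigma>' s' x)" using x by (simp add: compose_eq)
  have x': "signed_perm_map \<sigma>' s' x \<in> cube n d" using signed_perm_map_in_cube assms x by blast
  show "compose (cube n d) (signed_perm_map \<sigma> s) (signed_perm_map \<sigma>' s') x \<in> extensional {1..d}"
    unfolding c using signed_perm_map_in_cube[OF assms(1) x'] by (auto simp: cube_def PiE_def)
  fix j assume j: "j \<in> {1..d}"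
  have sj: "\<sigma> j \<in> {1..d}" "\<sigma>' (\<sigma> j) \<in> {1..d}"
    using j permutes_in_image[OF assms(1)] permutes_in_image[OF assms(2)] by auto
  then show "compose (cube n d) (signed_perm_map \<sigma> s) (signed_perm_map \<sigma>' s') x j
      = flip (s j \<noteq> s' (\<sigma> j)) (x ((\<sigma>' \<circ> \<sigma>) j))"
    unfolding c using j x x' cube_less[OF x sj(2)] by (simp add: signed_perm_map_apply flip_flip)
qed (simp add: compose_def)

abbreviation gens :: "((nat \<Rightarrow> nat) \<Rightarrow> (nat \<Rightarrow> nat)) set" where
  "gens \<equiv> rot_group n d \<union> coord_group n d \<union> swap_group n d"

lemma gens_subset: "gens \<subseteq> cube_automorphisms n d"
proof -
  have dd: "d - 1 \<in> {1..d}" "d \<in> {1..d}" using d2 by auto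
  have "rot n d i j \<in> cube_automorphisms n d" if "i \<in> {1..d}" "j \<in> {1..d}" "i \<noteq> j" for i j
    unfolding rot_eq[OF that] using that by (intro signed_perm_map_aut permutes_swap_id)
  then have "rot_group n d \<subseteq> cube_automorphisms n d" unfolding rot_group_def
    by (intro group.generate_subgroup_incl[OF group_BijGroup] subgroup_cube_automorphisms) auto
  moreover have "coord_group n d \<subseteq> cube_automorphisms n d"
    using coord_map_aut by (auto simp: coord_group_def)
  moreover have "swap_group n d \<subseteq> cube_automorphisms n d"
    unfolding swap_group_def swap_last_eq id_eq_signed_perm_map
    using dd by (auto intro!: signed_perm_map_aut permutes_swap_id permutes_id)
  ultimately show ?thesis by blast
qed

lemma generate_subset: "generate (cube_aut_group n d) gens \<subseteq> cube_automorphisms n d"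
  using group.generate_incl[OF group_cube_aut_group, of gens n d] gens_subset
  by (simp add: cube_aut_group_def)

lemma generate_compose:
  assumes "P \<in> generate (cube_aut_group n d) gens" "Q \<in> generate (cube_aut_group n d) gens"
  shows "compose (cube n d) P Q \<in> generate (cube_aut_group n d) gens"
proof -
  have "P \<in> Bij (cube n d)" "Q \<in> Bij (cube n d)"
    using assms generate_subset by (auto simp: cube_automorphisms_def)
  then have "P \<otimes>\<^bsub>cube_aut_group n d\<^esub> Q = compose (cube n d) P Q"
    by (simp add: cube_aut_group_def BijGroup_def)
  then show ?thesis using generate.eng[OF assms] by simp
qed

text \<open>Single reflections and transpositions are built from the rotations and the one swap,
  then assembled into arbitrary permutations and signs.\<close>

lemma generate_signed_perm_map:
  assumes \<sigma>: "\<sigma> permutes {1..d}"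
  shows "signed_perm_map \<sigma> s \<in> generate (cube_aut_group n d) gens"
proof -
  let ?H = "generate (cube_aut_group n d) gens"
  let ?F = "\<lambda>_::nat. False"
  let ?t = Transposition.transpose
  have dd: "d - 1 \<in> {1..d}" "d \<in> {1..d}" "d - 1 \<noteq> d" using d2 by auto
  have tp: "?t i j permutes {1..d}" if "i \<in> {1..d}" "j \<in> {1..d}" for i j
    using that by (rule permutes_swap_id)
  have idp: "id permutes {1..d}" by (rule permutes_id)
  have mult: "signed_perm_map (\<tau>' \<circ> \<tau>) (\<lambda>j. r j \<noteq> r' (\<tau> j)) \<in> ?H"
    if "\<tau> permutes {1..d}" "\<tau>' permutes {1..d}" "signed_perm_map \<tau> r \<in> ?H" "signed_perm_map \<tau>' r' \<in> ?H"
    for \<tau> \<tau>' r r'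
    using generate_compose[OF that(3,4)] unfolding signed_perm_map_compose[OF that(1,2)] .
  have rot: "signed_perm_map (?t i j) (\<lambda>k. k = i) \<in> ?H" if "i \<in> {1..d}" "j \<in> {1..d}" "i \<noteq> j" for i j
  proof -
    have "rot n d i j \<in> rot_group n d"
      unfolding rot_group_def using that by (intro generate.incl) blast
    then have "rot n d i j \<in> ?H" by (intro generate.incl) blast
    then show ?thesis using rot_eq[OF that] by simp
  qed
  have idH: "signed_perm_map id ?F \<in> ?H"
    unfolding id_eq_signed_perm_map[symmetric] swap_group_def by (intro generate.incl) blast
  have swap: "signed_perm_map (?t (d - 1) d) ?F \<in> ?H"
    unfolding swap_last_eq[symmetric] by (intro generate.incl) (simp add: swap_group_def)
  \<comment> \<open>The rotation and the swap share the transposition of the last two coordinates,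
    which cancels and leaves one reflection, at \<open>d - 1\<close>.\<close>
  have "signed_perm_map id (\<lambda>k. k = d - 1) \<in> ?H"
    using mult[OF tp[OF dd(1,2)] tp[OF dd(1,2)] rot[OF dd] swap] by (simp add: transpose_comp_involutory)
  note refl0 = this
  \<comment> \<open>A reflection at \<open>i\<close> cancels the one contained in the
    rotation.\<close>
  have transp: "signed_perm_map (?t i j) ?F \<in> ?H"
    if "signed_perm_map id (\<lambda>k. k = i) \<in> ?H" "i \<in> {1..d}" "j \<in> {1..d}" "i \<noteq> j" for i j
    using mult[OF idp tp[OF that(2,3)] that(1) rot[OF that(2-4)]] by simp
  \<comment> \<open>Transposing \<open>i\<close> with \<open>d - 1\<close> is available from
    \<open>refl0\<close>; it cancels the transposition in a rotation and leaves the reflection at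
    \<open>i\<close>.\<close>
  have refl: "signed_perm_map id (\<lambda>k. k = i) \<in> ?H" if i: "i \<in> {1..d}" for i
  proof (cases "i = d - 1")
    case False
    have "signed_perm_map (?t i (d - 1)) ?F \<in> ?H"
      using transp[OF refl0 dd(1) i] False by (simp add: transpose_commute)
    from mult[OF tp[OF i dd(1)] tp[OF i dd(1)] rot[OF i dd(1) False] this]
    show ?thesis by (simp add: transpose_comp_involutory)
  qed (use refl0 in simp)
  have perm: "signed_perm_map \<sigma> ?F \<in> ?H" using \<sigma> finite_atLeastAtMost
  proof (induction rule: permutes_induct)
    case id
    show ?case by (rule idH)
  next
    case (swap a b p)
    from mult[OF swap.hyps(4) tp[OF swap.hyps(1,2)] swap.IH
        transp[OF refl[OF swap.hyps(1)] swap.hyps(1-3)]]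
    show ?case by (simp add: comp_def)
  qed
  have sign: "signed_perm_map id (\<lambda>k. k \<in> S) \<in> ?H" if "finite S" "S \<subseteq> {1..d}" for S
    using that
  proof (induction S)
    case empty
    show ?case using idH by (simp add: id_def)
  next
    case (insert i S)
    have "(\<lambda>k. (k = i) \<noteq> (id k \<in> S)) = (\<lambda>k. k \<in> insert i S)" using insert(2) by auto
    then show ?case
      using mult[OF idp idp refl, of i "\<lambda>k. k \<in> S"] insert by (simp add: id_def comp_def)
  qed
  have "signed_perm_map id (\<lambda>k. k \<in> {k \<in> {1..d}. s k}) \<in> ?H" by (rule sign) auto
  from mult[OF idp \<sigma> this perm]
  have "signed_perm_map \<sigma> (\<lambda>k. k \<in> {1..d} \<and> s k) \<in> ?H" by (simp add: conj_ac)
  moreover have "signed_perm_map \<sigma> (\<lambda>k. k \<in> {1..d} \<and> s k) = signed_perm_map \<sigma> s"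
    by (rule signed_perm_map_eqI[OF \<sigma>]) (auto simp: signed_perm_map_def)
  ultimately show ?thesis by simp
qed

lemma generate_eq: "generate (cube_aut_group n d) gens = cube_automorphisms n d"
proof
  show "cube_automorphisms n d \<subseteq> generate (cube_aut_group n d) gens"
  proof
    fix P assume "P \<in> cube_automorphisms n d"
    then obtain \<sigma> s \<pi> where P: "\<sigma> permutes {1..d}" "symmetric_perm n \<pi>" "P = std_map \<sigma> s \<pi>"
      by (rule aut_std_map)
    have "coord_map n d \<pi> \<in> generate (cube_aut_group n d) gens"
      using P(2) by (intro generate.incl) (auto simp: coord_group_def)
    then show "P \<in> generate (cube_aut_group n d) gens"
      unfolding P(3) std_map_def using generate_compose generate_signed_perm_map[OF P(1)] by blast
  qed
qed (rule generate_subset)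

subsection \<open>The order of the group\<close>

lemma symmetric_permI:
  assumes "\<pi> permutes {0..<n}" "\<And>t. t < n \<Longrightarrow> \<pi> (n - 1 - t) = n - 1 - \<pi> t"
  shows "symmetric_perm n \<pi>"
  using assms unfolding symmetric_perm_def by (auto simp: diff_commute)

lemma symmetric_perm_rev: "symmetric_perm n \<pi> \<Longrightarrow> t < n \<Longrightarrow> \<pi> (n - 1 - t) = n - 1 - \<pi> t"
  using symmetric_perm_flip[of \<pi> t True] by (simp add: flip_def)

lemma symmetric_perm_inj: "symmetric_perm n \<pi> \<Longrightarrow> \<pi> t = \<pi> u \<longleftrightarrow> t = u"
  by (meson symmetric_perm_def permutes_inj inj_eq)

text \<open>
  Reversing all coordinates is both a signed permutation and a symmetric permutation of the
  values; requiring the first coordinate to carry no sign removes this ambiguity.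
\<close>

lemma aut_normal_form:
  assumes "P \<in> cube_automorphisms n d"
  shows "\<exists>\<sigma> S \<pi>. \<sigma> permutes {1..d} \<and> S \<subseteq> {2..d} \<and> symmetric_perm n \<pi> \<and> P = std_map \<sigma> (\<lambda>j. j \<in> S) \<pi>"
proof -
  obtain \<sigma> s \<pi> where P: "\<sigma> permutes {1..d}" "symmetric_perm n \<pi>" "P = std_map \<sigma> s \<pi>"
    using aut_std_map[OF assms] by blast
  \<comment> \<open>The reflection at coordinate \<open>1\<close> moves into the value permutation,
    and \<open>S\<close> records the signs relative to it.\<close>
  define \<rho> where "\<rho> t = (if t < n then flip (s 1) (\<pi> t) else t)" for t
  define S where "S = {j \<in> {2..d}. s j \<noteq> s 1}"
  have lt: "\<pi> t < n" if "t < n" for t using symmetric_perm_less[OF P(2) that] .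
  have inj: "inj_on \<rho> {0..<n}"
    using lt symmetric_perm_inj[OF P(2)] by (auto simp: inj_on_def \<rho>_def flip_inj)
  have sub: "\<rho> ` {0..<n} \<subseteq> {0..<n}" using lt by (auto simp: \<rho>_def flip_less)
  have "\<rho> permutes {0..<n}"
    using endo_inj_surj[OF _ sub inj] inj
    by (intro bij_imp_permutes) (auto simp: bij_betw_def \<rho>_def)
  then have \<rho>: "symmetric_perm n \<rho>"
  proof (rule symmetric_permI)
    fix t assume t: "t < n"
    have "n - 1 - t < n" using t by simp
    then show "\<rho> (n - 1 - t) = n - 1 - \<rho> t"
      using t lt[OF t] symmetric_perm_rev[OF P(2) t] by (auto simp: \<rho>_def flip_def)
  qed
  have "std_map \<sigma> s \<pi> = std_map \<sigma> (\<lambda>j. j \<in> S) \<rho>"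
  proof (rule aut_eqI)
    fix x j assume x: "x \<in> cube n d" and j: "j \<in> {1..d}"
    have xj: "x (\<sigma> j) < n" using cube_less[OF x] permutes_in_image[OF P(1)] j by blast
    have "(j \<in> S) = (s j \<noteq> s 1)" using j unfolding S_def by (cases "j = 1") auto
    then have "((j \<in> S) \<noteq> s 1) = s j" by blast
    then show "std_map \<sigma> s \<pi> x j = std_map \<sigma> (\<lambda>j. j \<in> S) \<rho> x j"
      using std_map_apply[OF P(1,2) x j] std_map_apply[OF P(1) \<rho> x j] flip_flip[OF lt[OF xj], of "j \<in> S" "s 1"] xj
      by (simp add: \<rho>_def)
  qed (use P \<rho> std_map_aut in auto)
  then show ?thesis using P \<rho> by (intro exI[of _ \<sigma>] exI[of _ S] exI[of _ \<rho>]) (auto simp: S_def)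
qed

text \<open>Test points separate the data: the origin and an axis point detect
  \<open>\<sigma>\<close>, the constant points detect \<open>\<pi>\<close> on the unsigned
  coordinate \<open>1\<close>, and a position not sent to the middle value detects
  \<open>S\<close>.\<close>

lemma std_map_inj:
  assumes \<sigma>: "\<sigma> permutes {1..d}" "\<sigma>' permutes {1..d}" and S: "S \<subseteq> {2..d}" "S' \<subseteq> {2..d}"
    and \<pi>: "symmetric_perm n \<pi>" "symmetric_perm n \<pi>'"
    and eq: "std_map \<sigma> (\<lambda>j. j \<in> S) \<pi> = std_map \<sigma>' (\<lambda>j. j \<in> S') \<pi>'"
  shows "\<sigma> = \<sigma>' \<and> S = S' \<and> \<pi> = \<pi>'"
proof -
  have e: "flip (j \<in> S) (\<pi> (x (\<sigma> j))) = flip (j \<in> S') (\<pi>' (x (\<sigma>' j)))"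
    if "x \<in> cube n d" "j \<in> {1..d}" for x j
    using std_map_apply[OF \<sigma>(1) \<pi>(1) that] std_map_apply[OF \<sigma>(2) \<pi>(2) that] eq by metis
  have s: "\<sigma> j = \<sigma>' j" if j: "j \<in> {1..d}" for j
  proof (rule ccontr)
    assume ne: "\<sigma> j \<noteq> \<sigma>' j"
    have sj: "\<sigma> j \<in> {1..d}" "\<sigma>' j \<in> {1..d}"
      using j permutes_in_image[OF \<sigma>(1)] permutes_in_image[OF \<sigma>(2)] by auto
    have "0 < n" "1 < n" using n3 by auto
    note c = this
    \<comment> \<open>Raising only coordinate \<open>\<sigma> j\<close> of the origin to
      \<open>1\<close> is invisible to \<open>\<sigma>'\<close> at \<open>j\<close>, so
      \<open>\<pi> 0\<close> and \<open>\<pi> 1\<close> would coincide.\<close>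
    have "flip (j \<in> S) (\<pi> 0) = flip (j \<in> S') (\<pi>' 0)"
      using e[OF ind_pt_in_cube[OF c(1)] j, of "{}"] sj by (simp add: ind_pt_apply)
    moreover have "flip (j \<in> S) (\<pi> 1) = flip (j \<in> S') (\<pi>' 0)"
      using e[OF ind_pt_in_cube[OF c(2)] j, of "{\<sigma> j}"] sj ne by (simp add: ind_pt_apply)
    ultimately have "flip (j \<in> S) (\<pi> 0) = flip (j \<in> S) (\<pi> 1)" by simp
    then have "\<pi> 0 = \<pi> 1" using flip_inj symmetric_perm_less[OF \<pi>(1)] c by blast
    then show False using symmetric_perm_inj[OF \<pi>(1)] by simp
  qed
  have ss: "\<sigma> = \<sigma>'"
  proof
    fix j show "\<sigma> j = \<sigma>' j"
      using s \<sigma> by (cases "j \<in> {1..d}") (simp_all add: permutes_not_in)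
  qed
  have e': "flip (j \<in> S) (\<pi> t) = flip (j \<in> S') (\<pi>' t)" if "t < n" "j \<in> {1..d}" for t j
  proof -
    have "\<sigma> j \<in> {1..d}" using that permutes_in_image[OF \<sigma>(1)] by blast
    then show ?thesis using e[OF const_pt_in_cube[OF that(1)] that(2)] ss by (simp add: const_pt_apply)
  qed
  have "1 \<notin> S" "1 \<notin> S'" using S by auto
  then have p: "\<pi> t = \<pi>' t" if "t < n" for t using e'[OF that coordinates_nonempty(1)] by simp
  have pp: "\<pi> = \<pi>'"
  proof
    fix t show "\<pi> t = \<pi>' t"
      using p \<pi> by (cases "t < n") (auto simp: symmetric_perm_def permutes_not_in)
  qed
  have "j \<in> S \<longleftrightarrow> j \<in> S'" if j: "j \<in> {1..d}" for j
  proof -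
    \<comment> \<open>At most one of \<open>\<pi> 0\<close> and \<open>\<pi> 1\<close> is the middle
      value.\<close>
    have "\<pi> 0 \<noteq> \<pi> 1" using symmetric_perm_inj[OF \<pi>(1)] by simp
    then obtain t where t: "t < n" "2 * \<pi> t \<noteq> n - 1"
      using n3 by (cases "2 * \<pi> 0 = n - 1") (auto intro: that[of 0] that[of 1])
    show ?thesis
      using e'[OF t(1) j] t flip_eq_cases[OF symmetric_perm_less[OF \<pi>(1) t(1)], of "j \<in> S" "j \<in> S'"]
      by (simp add: pp)
  qed
  then have "S = S'" using S by force
  then show ?thesis using ss pp by blast
qed

section \<open>Counting symmetric permutations\<close>

text \<open>A signed permutation of the \<open>n div 2\<close> mirror pairs, each represented by its
  lower value: \<open>\<tau>\<close> permutes the pairs and \<open>B\<close> marks those whose lower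
  value is sent to the upper half. For odd \<open>n\<close> the middle value stays fixed.\<close>

definition sym_ext :: "(nat \<Rightarrow> nat) \<Rightarrow> nat set \<Rightarrow> nat \<Rightarrow> nat" where
  "sym_ext \<tau> B t = (if t < n div 2 then flip (t \<in> B) (\<tau> t)
     else if t < n \<and> n - 1 - t < n div 2 then n - 1 - flip (n - 1 - t \<in> B) (\<tau> (n - 1 - t)) else t)"

lemma sym_ext_symmetric:
  assumes \<tau>: "\<tau> permutes {..<n div 2}"
  shows "symmetric_perm n (sym_ext \<tau> B)"
proof -
  let ?k = "n div 2" and ?r = "sym_ext \<tau> B"
  have tl: "\<tau> t < ?k" if "t < ?k" for t using permutes_in_image[OF \<tau>, of t] that by simp
  have lt: "?r t < n" if "t < n" for t
    using that tl[of t] flip_less[of "\<tau> t"] by (auto simp: sym_ext_def)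
  have rev: "?r (n - 1 - t) = n - 1 - ?r t" if t: "t < n" for t
  proof -
    consider "t < ?k" | "n - 1 - t < ?k" | "\<not> t < ?k" "\<not> n - 1 - t < ?k" by blast
    then show ?thesis
    proof cases
      case 1
      then have "\<not> n - 1 - t < ?k" "n - 1 - (n - 1 - t) = t" using t by linarith+
      then show ?thesis using 1 t by (simp add: sym_ext_def)
    next
      case 2
      then have "\<not> t < ?k" using t by linarith
      moreover have "flip (n - 1 - t \<in> B) (\<tau> (n - 1 - t)) < n"
        using tl[OF 2] by (intro flip_less) linarith
      ultimately show ?thesis using 2 t by (simp add: sym_ext_def)
    next
      case 3
      then show ?thesis using t by (simp add: sym_ext_def)
    qed
  qed
  \<comment> \<open>Surjectivity is enough on a finite set, and by symmetry it suffices to reach the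
    lower half; if \<open>t\<close> yields the mirror image of \<open>y\<close>, then the mirror
    image of \<open>t\<close> yields \<open>y\<close>.\<close>
  have low: "\<exists>t<n. ?r t = y" if y: "y < ?k" for y
  proof -
    obtain t where t: "t < ?k" "\<tau> t = y"
      using y permutes_image[OF \<tau>] by (metis imageE lessThan_iff)
    have tn: "t < n" using t by linarith
    show ?thesis
    proof (cases "t \<in> B")
      case False
      then show ?thesis using t tn by (intro exI[of _ t]) (simp add: sym_ext_def)
    next
      case True
      then have "?r t = n - 1 - y" using t by (simp add: sym_ext_def flip_def)
      then have "?r (n - 1 - t) = n - 1 - (n - 1 - y)" using rev[OF tn] by simp
      then show ?thesis using tn y by (intro exI[of _ "n - 1 - t"]) auto
    qed
  qed
  have surj: "\<exists>t<n. ?r t = y" if y: "y < n" for y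
  proof -
    consider "y < ?k" | "n - 1 - y < ?k" | "\<not> y < ?k" "\<not> n - 1 - y < ?k" by blast
    then show ?thesis
    proof cases
      case 1
      then show ?thesis by (rule low)
    next
      case 2
      then obtain t where t: "t < n" "?r t = n - 1 - y" using low by blast
      then show ?thesis using rev[OF t(1)] y by (intro exI[of _ "n - 1 - t"]) auto
    next
      case 3
      then show ?thesis using y by (intro exI[of _ y]) (simp add: sym_ext_def)
    qed
  qed
  have im: "?r ` {0..<n} = {0..<n}"
  proof
    show "?r ` {0..<n} \<subseteq> {0..<n}" using lt by auto
    show "{0..<n} \<subseteq> ?r ` {0..<n}"
    proof
      fix y assume "y \<in> {0..<n}"
      then obtain t where "t < n" "?r t = y" using surj[of y] by auto
      then show "y \<in> ?r ` {0..<n}" by auto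
    qed
  qed
  then have "bij_betw ?r {0..<n} {0..<n}"
    unfolding bij_betw_def by (simp add: eq_card_imp_inj_on)
  then have "?r permutes {0..<n}"
    by (rule bij_imp_permutes) (auto simp: sym_ext_def)
  then show ?thesis using rev by (rule symmetric_permI)
qed

text \<open>\<open>B\<close> collects the lower values sent out of the lower half, and reflecting
  their images gives \<open>\<tau>\<close>.\<close>

lemma sym_ext_surj:
  assumes \<pi>: "symmetric_perm n \<pi>"
  shows "\<exists>\<tau> B. \<tau> permutes {..<n div 2} \<and> B \<subseteq> {..<n div 2} \<and> \<pi> = sym_ext \<tau> B"
proof -
  let ?k = "n div 2"
  define B where "B = {t \<in> {..<?k}. \<not> \<pi> t < ?k}"
  define \<tau> where "\<tau> t = (if t < ?k then flip (t \<in> B) (\<pi> t) else t)" for t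
  have lt: "\<pi> t < n" if "t < n" for t using symmetric_perm_less[OF \<pi> that] .
  have rev: "\<pi> (n - 1 - t) = n - 1 - \<pi> t" if "t < n" for t using symmetric_perm_rev[OF \<pi> that] .
  \<comment> \<open>Being one's own mirror image characterises the middle value and is preserved by
    \<open>\<pi>\<close>. So no lower value is sent to the middle, and reflection brings an image
    outside the lower half into it.\<close>
  have mid: "2 * \<pi> t = n - 1 \<longleftrightarrow> 2 * t = n - 1" if t: "t < n" for t
  proof -
    have "2 * \<pi> t = n - 1 \<longleftrightarrow> \<pi> t = \<pi> (n - 1 - t)" using rev[OF t] lt[OF t] by linarith
    also have "\<dots> \<longleftrightarrow> t = n - 1 - t" by (rule symmetric_perm_inj[OF \<pi>])
    also have "\<dots> \<longleftrightarrow> 2 * t = n - 1" using t by linarith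
    finally show ?thesis .
  qed
  have \<tau>lt: "\<tau> t < ?k" if t: "t < ?k" for t
  proof (cases "t \<in> B")
    case True
    have tn: "t < n" "2 * t \<noteq> n - 1" using t by linarith+
    have "2 * \<pi> t \<noteq> n - 1" using mid[OF tn(1)] tn(2) by simp
    then show ?thesis using True t lt[OF tn(1)] by (simp add: \<tau>_def flip_def B_def)
  next
    case False
    then show ?thesis using t by (simp add: \<tau>_def B_def)
  qed
  have inj: "inj_on \<tau> {..<?k}"
  proof (rule inj_onI)
    fix t u assume tu: "t \<in> {..<?k}" "u \<in> {..<?k}" "\<tau> t = \<tau> u"
    have n: "t < n" "u < n" using tu by auto
    have "\<pi> t = \<pi> u \<or> \<pi> t = n - 1 - \<pi> u"
      using tu lt[OF n(1)] lt[OF n(2)] by (auto simp: \<tau>_def flip_def split: if_splits)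
    then have "\<pi> t = \<pi> u \<or> \<pi> t = \<pi> (n - 1 - u)" using rev[OF n(2)] by simp
    then have "t = u \<or> t = n - 1 - u" by (simp only: symmetric_perm_inj[OF \<pi>])
    then show "t = u" using tu by auto
  qed
  have "\<tau> ` {..<?k} \<subseteq> {..<?k}" using \<tau>lt by auto
  then have "bij_betw \<tau> {..<?k} {..<?k}"
    using endo_inj_surj[OF _ _ inj] inj by (simp add: bij_betw_def)
  then have \<tau>: "\<tau> permutes {..<?k}" by (rule bij_imp_permutes) (auto simp: \<tau>_def)
  have low: "flip (t \<in> B) (\<tau> t) = \<pi> t" if t: "t < ?k" for t
  proof -
    have "t < n" using t by linarith
    then show ?thesis using t lt[of t] by (simp add: \<tau>_def flip_flip)
  qed
  have "\<pi> = sym_ext \<tau> B"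
  proof
    fix t
    consider "t < ?k" | "\<not> t < ?k" "t < n" "n - 1 - t < ?k" | "\<not> t < ?k" "t < n" "\<not> n - 1 - t < ?k"
      | "\<not> t < n" by blast
    then show "\<pi> t = sym_ext \<tau> B t"
    proof cases
      case 1
      then show ?thesis using low by (simp add: sym_ext_def)
    next
      case 2
      have "\<pi> t = n - 1 - \<pi> (n - 1 - t)" using rev[OF 2(2)] lt[OF 2(2)] by simp
      then show ?thesis using 2 low[OF 2(3)] by (simp add: sym_ext_def)
    next
      case 3
      then have "2 * t = n - 1" by linarith
      then have "\<pi> t = t" using mid[OF 3(2)] by linarith
      then show ?thesis using 3 by (simp add: sym_ext_def)
    next
      case 4
      have "\<pi> t = t" using \<pi> 4 by (auto simp: symmetric_perm_def permutes_not_in)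
      moreover have "\<not> t < ?k" using 4 by linarith
      ultimately show ?thesis using 4 by (simp add: sym_ext_def)
    qed
  qed
  then show ?thesis using \<tau> by (intro exI[of _ \<tau>] exI[of _ B]) (auto simp: B_def)
qed

text \<open>The image of a lower value leaves the lower half exactly when it has been reflected, so
  both \<open>B\<close> and \<open>\<tau>\<close> are visible there.\<close>

lemma sym_ext_inj:
  assumes \<tau>: "\<tau> permutes {..<n div 2}" "\<tau>' permutes {..<n div 2}"
    and B: "B \<subseteq> {..<n div 2}" "B' \<subseteq> {..<n div 2}" and eq: "sym_ext \<tau> B = sym_ext \<tau>' B'"
  shows "\<tau> = \<tau>' \<and> B = B'"
proof -
  let ?k = "n div 2"
  have key: "\<tau> t = \<tau>' t \<and> (t \<in> B \<longleftrightarrow> t \<in> B')" if t: "t < ?k" for t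
  proof -
    have "flip (t \<in> B) (\<tau> t) = flip (t \<in> B') (\<tau>' t)"
      using fun_cong[OF eq, of t] t by (simp add: sym_ext_def)
    moreover have "\<tau> t < ?k" "\<tau>' t < ?k"
      using permutes_in_image[OF \<tau>(1), of t] permutes_in_image[OF \<tau>(2), of t] t by auto
    ultimately show ?thesis by (auto simp: flip_def split: if_splits)
  qed
  have "\<tau> = \<tau>'"
  proof
    fix t show "\<tau> t = \<tau>' t" using key \<tau> by (cases "t < ?k") (simp_all add: permutes_not_in)
  qed
  moreover have "B = B'" using key B by blast
  ultimately show ?thesis by blast
qed

lemma card_symmetric_perm: "card {\<pi>. symmetric_perm n \<pi>} = fact (n div 2) * 2 ^ (n div 2)"
proof -
  let ?D = "{\<tau>. \<tau> permutes {..<n div 2}} \<times> Pow {..<n div 2}"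
  have "bij_betw (\<lambda>(\<tau>, B). sym_ext \<tau> B) ?D {\<pi>. symmetric_perm n \<pi>}"
    unfolding bij_betw_def
  proof
    show "inj_on (\<lambda>(\<tau>, B). sym_ext \<tau> B) ?D"
      using sym_ext_inj by (auto simp: inj_on_def)
    show "(\<lambda>(\<tau>, B). sym_ext \<tau> B) ` ?D = {\<pi>. symmetric_perm n \<pi>}"
    proof
      show "(\<lambda>(\<tau>, B). sym_ext \<tau> B) ` ?D \<subseteq> {\<pi>. symmetric_perm n \<pi>}"
        using sym_ext_symmetric by auto
      show "{\<pi>. symmetric_perm n \<pi>} \<subseteq> (\<lambda>(\<tau>, B). sym_ext \<tau> B) ` ?D"
        using sym_ext_surj by (fastforce simp: image_iff)
    qed
  qed
  then have "card {\<pi>. symmetric_perm n \<pi>} = card ?D" by (metis bij_betw_same_card)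
  then show ?thesis by (simp add: card_cartesian_product card_permutations card_Pow)
qed

lemma card_automorphisms:
  "card (cube_automorphisms n d) = 2 ^ (d - 1 + n div 2) * fact d * fact (n div 2)"
proof -
  let ?D = "{\<sigma>. \<sigma> permutes {1..d}} \<times> Pow {2..d} \<times> {\<pi>. symmetric_perm n \<pi>}"
  let ?f = "\<lambda>(\<sigma>, S, \<pi>). std_map \<sigma> (\<lambda>j. j \<in> S) \<pi>"
  have "bij_betw ?f ?D (cube_automorphisms n d)"
    unfolding bij_betw_def
  proof
    show "inj_on ?f ?D"
    proof (rule inj_onI)
      fix u v assume u: "u \<in> ?D" and v: "v \<in> ?D" and e: "?f u = ?f v"
      obtain \<sigma> S \<pi> \<sigma>' S' \<pi>' where uv: "u = (\<sigma>, S, \<pi>)" "v = (\<sigma>', S', \<pi>')" by (metis prod_cases3)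
      show "u = v" using std_map_inj[of \<sigma> \<sigma>' S S' \<pi> \<pi>'] u v e unfolding uv by auto
    qed
    show "?f ` ?D = cube_automorphisms n d"
    proof
      show "?f ` ?D \<subseteq> cube_automorphisms n d" using std_map_aut by auto
      show "cube_automorphisms n d \<subseteq> ?f ` ?D"
      proof
        fix P assume "P \<in> cube_automorphisms n d"
        then obtain \<sigma> S \<pi> where "\<sigma> permutes {1..d}" "S \<subseteq> {2..d}" "symmetric_perm n \<pi>"
          and P: "P = ?f (\<sigma>, S, \<pi>)" using aut_normal_form by fastforce
        then have "(\<sigma>, S, \<pi>) \<in> ?D" by simp
        then show "P \<in> ?f ` ?D" unfolding P by (rule imageI)
      qed
    qed
  qed
  then have "card (cube_automorphisms n d) = card ?D" by (metis bij_betw_same_card)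
  also have "\<dots> = fact d * (2 ^ (d - 1) * (fact (n div 2) * 2 ^ (n div 2)))"
    by (simp add: card_cartesian_product card_permutations card_Pow card_symmetric_perm)
  finally show ?thesis by (simp add: power_add)
qed

end

theorem theorem1:
  fixes n d k :: nat
  assumes "n \<ge> 3" and "d \<ge> 2" and "k = n div 2"
  shows "generate (cube_aut_group n d) (rot_group n d \<union> coord_group n d \<union> swap_group n d)
           = carrier (cube_aut_group n d)
         \<and> order (cube_aut_group n d) = 2 ^ (d - 1 + k) * fact d * fact k"
proof -
  interpret grid n d using assms by unfold_locales
  have "carrier (cube_aut_group n d) = cube_automorphisms n d"
    by (simp add: cube_aut_group_def)
  then show ?thesis
    using generate_eq card_automorphisms assms(3) by (simp add: order_def)
qed

end
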